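(* Let $\varepsilon > 0$ be fixed. For all real $x \geq 1$ and all integers $q \geq 1$ with $q \leq x$, we have $$V(x;q) \ll x^{\varepsilon} \left( x^{1/2} q^{1/2} + \frac{x}{q^{1/2}} \right).$$ In particular, for $x^{1/2} \leq q \leq x$, we have $$V(x;q) \ll x^{1/2 + \varepsilon} q^{1/2}.$$
   Context: For real $x \geq 1$, an integer $q \geq 1$ with $q \leq x$, and $a \in (\mathbb{Z}/q\mathbb{Z})^{\times}$, let $$S(x;q,a) = \sum_{\substack{1 \leq n \leq x \\ n \equiv a \ (\mathrm{mod}\ q)}} |\mu(n)|,$$ where $\mu$ is the Möbius function (so $|\mu|$ is the indicator function of squarefree integers), and define $E(x;q,a)$ by $$S(x;q,a) = c_q \frac{x}{q} + E(x;q,a), \qquad c_q = \prod_{p \nmid q} \left( 1 - \frac{1}{p^2} \right),$$ the product being over primes $p$ not dividing $q$. Define $$V(x;q) = \sum_{a \in (\mathbb{Z}/q\mathbb{Z})^{\times}} E(x;q,a)^2.$$ The notation $A \ll B$ means that $|A| \leq C B$ for some constant $C > 0$ depending only on $\varepsilon$ (in particular, independent of $x$ and $q$). *)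

theory Defs
  imports "HOL-Analysis.Analysis" "HOL-Number_Theory.Number_Theory"
    "HOL-Computational_Algebra.Squarefree"
begin

definition moebius :: "nat \<Rightarrow> int" where
  "moebius n = (if squarefree n then (-1) ^ card (prime_factors n) else 0)"

lemma abs_moebius: "\<bar>moebius n\<bar> = (if squarefree n then 1 else 0)"
  by (simp add: moebius_def power_abs)

definition sqfree_count :: "real \<Rightarrow> nat \<Rightarrow> nat \<Rightarrow> real" where
  "sqfree_count x q a =
     (\<Sum>n | 1 \<le> n \<and> real n \<le> x \<and> [n = a] (mod q). real_of_int \<bar>moebius n\<bar>)"

lemma finite_sqfree_count_range:
  "finite {n. 1 \<le> n \<and> real n \<le> x \<and> [n = a] (mod q)}"
proof (rule finite_subset)
  show "{n. 1 \<le> n \<and> real n \<le> x \<and> [n = a] (mod q)} \<subseteq> {..nat \<lfloor>x\<rfloor>}"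
    by (auto simp: le_nat_floor)
qed simp

(* The index runs over all natural numbers; those that are not primes or that
   divide q contribute the factor 1. *)
definition sqfree_density :: "nat \<Rightarrow> real" where
  "sqfree_density q =
     prodinf (\<lambda>p. if prime p \<and> \<not> p dvd q then 1 - 1 / real p ^ 2 else 1)"

lemma sqfree_density_has_prod:
  "(\<lambda>p. if prime p \<and> \<not> p dvd q then 1 - 1 / real p ^ 2 else 1) has_prod sqfree_density q"
proof -
  let ?f = "\<lambda>p::nat. if prime p \<and> \<not> p dvd q then 1 - 1 / real p ^ 2 else (1::real)"
  have "summable (\<lambda>p. norm (?f p - 1))"
  proof (rule summable_comparison_test)
    show "\<exists>N. \<forall>n\<ge>N. norm (norm (?f n - 1)) \<le> inverse (real n ^ 2)"
      by (auto simp: field_simps)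
    show "summable (\<lambda>n. inverse (real n ^ 2))"
      using inverse_power_summable[of 2, where 'a = real] by simp
  qed
  then have "convergent_prod ?f"
    by (intro abs_convergent_prod_imp_convergent_prod summable_imp_abs_convergent_prod)
  then show ?thesis
    unfolding sqfree_density_def by (rule convergent_prod_has_prod)
qed

definition sqfree_error :: "real \<Rightarrow> nat \<Rightarrow> nat \<Rightarrow> real" where
  "sqfree_error x q a = sqfree_count x q a - sqfree_density q * (x / real q)"

(* The unit group of Z/qZ is represented by its residues in {1..q}, so that
   totatives 1 = {1} is the single class modulo 1. *)
definition sqfree_variance :: "real \<Rightarrow> nat \<Rightarrow> real" where
  "sqfree_variance x q = (\<Sum>a\<in>totatives q. (sqfree_error x q a)^2)"

end

(* Writing |mu n| as the sum of mu d over d^2 | n gives, for a prime to q,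
     E(x; q, a) = sum_{d <= sqrt x, (d, q) = 1} mu d * Delta_d(a) + O(sqrt x / q),
   where Delta_d(a) is the discrepancy of the l <= x / d^2 with d^2 l = a (mod q). It depends only on
   floor (x / d^2) mod q, so the l may be taken from [1, r_d] with r_d <= min q (x / d^2). After a
   dyadic decomposition in d, opening the square and summing over all residues leaves the
   correlations of Delta_d and Delta_e for d and e of the same size. Each of them is the error in
   counting the points of the lattice d^2 l = e^2 l' (mod q), of determinant q, in a box with sides at
   most K = min q (x / d^2), and this error is O(K / lambda), where lambda is the length of a shortest
   nonzero lattice vector. It remains to bound the sum of 1 / lambda over d, e <= D. Pull out the gcd
   of d and e. The coprime pairs with lambda > T := min D (sqrt q) contribute at most D^2 / T. The
   others satisfy u d^2 = v e^2 (mod q) for some |u|, |v| <= T, and for given (u, v) there are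
   O(tau(q) (1 + D^2 gcd(u, q) / q)) of them. The total is O(q^eps (D + D^2 / sqrt q)), and
   K D <= sqrt (x q), K D^2 / sqrt q <= x / sqrt q. *)

theory Submission
  imports Defs "HOL-Library.Discrete_Functions"
begin

section \<open>Lattice points in boxes\<close>

text \<open>Both terms of the theorem are already visible in the sum of 1 / lambda. For d = e the
  vector (1, 1) lies in the lattice, so lambda = 1 and the diagonal alone costs D; by the pigeonhole
  principle lambda never exceeds sqrt q, so all pairs together cost at least their number over sqrt
  q. What has to be excluded is that intermediate values of lambda cost more. T is the threshold at
  which the trivial bound D^2 / T equals the larger of D and D^2 / sqrt q. Passing from the units to
  all residues is allowed because squares are nonnegative, and it makes the main terms collapse:
  what is left is exactly a lattice count minus area over determinant, without a coprimality
  condition on the points. The dyadic cut gives all d and e of a block one common K, and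
  Cauchy-Schwarz over the blocks loses only logarithms. Reducing the lengths modulo q is essential:
  K <= q and K D^2 <= x together give (K D)^2 <= x q.\<close>

lemma card_multiples_le:
  fixes q L W :: int
  assumes "q > 0" "W \<ge> 0"
  shows "finite {j. L \<le> j * q \<and> j * q \<le> L + W}"
    and "real (card {j. L \<le> j * q \<and> j * q \<le> L + W}) \<le> W / q + 1"
proof -
  have sub: "{j. L \<le> j * q \<and> j * q \<le> L + W} \<subseteq> {\<lceil>L / q\<rceil>..\<lfloor>(L + W) / q\<rfloor>}"
  proof safe
    fix j assume j: "L \<le> j * q" "j * q \<le> L + W"
    have "real_of_int L \<le> j * q" "j * q \<le> real_of_int (L + W)"
      using j by (simp_all only: of_int_mult[symmetric] of_int_le_iff)
    with assms show "j \<in> {\<lceil>L / q\<rceil>..\<lfloor>(L + W) / q\<rfloor>}"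
      by (auto simp: ceiling_le_iff le_floor_iff field_simps)
  qed
  then show "finite {j. L \<le> j * q \<and> j * q \<le> L + W}" by (rule finite_subset) simp
  have "card {j. L \<le> j * q \<and> j * q \<le> L + W} \<le> nat (\<lfloor>(L + W) / q\<rfloor> - \<lceil>L / q\<rceil> + 1)"
    using card_mono[OF _ sub] by (simp add: algebra_simps)
  moreover have "real (nat (\<lfloor>(L + W) / q\<rfloor> - \<lceil>L / q\<rceil> + 1)) \<le> W / q + 1"
  proof -
    define Z where "Z = \<lfloor>(L + W) / q\<rfloor> - \<lceil>L / q\<rceil> + 1"
    have "real_of_int Z \<le> (L + W) / q - L / q + 1"
      unfolding Z_def by linarith
    also have "\<dots> = W / q + 1" by (simp add: add_divide_distrib)
    finally have "real_of_int Z \<le> W / q + 1" .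
    moreover have "W / q + 1 \<ge> 0" using assms by simp
    ultimately have "real (nat Z) \<le> W / q + 1" by (cases "Z \<ge> 0") auto
    then show ?thesis unfolding Z_def .
  qed
  ultimately show "real (card {j. L \<le> j * q \<and> j * q \<le> L + W}) \<le> W / q + 1" by linarith
qed

text \<open>In the application \<open>A\<close> and \<open>B\<close> are the squares of two moduli
  \<open>d\<close> and \<open>e\<close>. The sides are arbitrary sets, so that a box can be cut into
  strips.\<close>

definition lat_box :: "int \<Rightarrow> int \<Rightarrow> int \<Rightarrow> int set \<Rightarrow> int set \<Rightarrow> (int \<times> int) set" where
  "lat_box q A B I J = {(a, b). a \<in> I \<and> b \<in> J \<and> q dvd a * A - b * B}"

lemma finite_lat_box [simp]: "finite I \<Longrightarrow> finite J \<Longrightarrow> finite (lat_box q A B I J)"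
  by (rule finite_subset[of _ "I \<times> J"]) (auto simp: lat_box_def)

lemma card_lat_box_Un1:
  assumes "finite I" "finite I'" "finite J" "I \<inter> I' = {}"
  shows "card (lat_box q A B (I \<union> I') J) = card (lat_box q A B I J) + card (lat_box q A B I' J)"
proof -
  have "lat_box q A B (I \<union> I') J = lat_box q A B I J \<union> lat_box q A B I' J"
    by (auto simp: lat_box_def)
  moreover have "lat_box q A B I J \<inter> lat_box q A B I' J = {}"
    using assms(4) by (auto simp: lat_box_def)
  ultimately show ?thesis using assms by (simp add: card_Un_disjoint)
qed

lemma card_lat_box_Un2:
  assumes "finite J" "finite J'" "finite I" "J \<inter> J' = {}"
  shows "card (lat_box q A B I (J \<union> J')) = card (lat_box q A B I J) + card (lat_box q A B I J')"
proof -
  have "lat_box q A B I (J \<union> J') = lat_box q A B I J \<union> lat_box q A B I J'"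
    by (auto simp: lat_box_def)
  moreover have "lat_box q A B I J \<inter> lat_box q A B I J' = {}"
    using assms(4) by (auto simp: lat_box_def)
  ultimately show ?thesis using assms by (simp add: card_Un_disjoint)
qed

lemma lat_box_swap: "card (lat_box q A B I J) = card (lat_box q B A J I)"
proof -
  have "bij_betw prod.swap (lat_box q A B I J) (lat_box q B A J I)"
    by (rule bij_betwI[of _ _ _ prod.swap])
       (auto simp: lat_box_def dvd_diff_commute)
  then show ?thesis by (rule bij_betw_same_card)
qed

text \<open>The determinant of two lattice vectors is a multiple of the lattice determinant
  \<open>q\<close>: times the unit \<open>B\<close> it is a combination of the two
  congruences.\<close>

lemma lat_line_dvd:
  fixes q :: int
  assumes "coprime B q" "q dvd u * A - v * B" "q dvd a * A - b * B"
  shows "q dvd u * b - v * a"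
proof -
  have "(u * b - v * a) * B = a * (u * A - v * B) - u * (a * A - b * B)"
    by (simp add: algebra_simps)
  then have "q dvd (u * b - v * a) * B"
    using assms by (metis dvd_diff dvd_mult)
  with assms(1) show ?thesis by (metis coprime_commute coprime_dvd_mult_left_iff)
qed

text \<open>The lines parallel to a shortest vector (u, v) that meet the strip are numbered by the
  integer (u b - v a) / q, and by minimality each of them carries at most one lattice point of a
  strip of width u.\<close>

lemma lat_box_block_le:
  fixes q A B u v c \<alpha> R :: int
  assumes q: "q > 0" "coprime B q" and u: "u > 0" "\<bar>v\<bar> \<le> u" "u^2 \<le> q" "q dvd u * A - v * B"
    and min: "\<And>a b. q dvd a * A - b * B \<Longrightarrow> \<bar>a\<bar> < u \<Longrightarrow> \<bar>b\<bar> < u \<Longrightarrow> a = 0 \<and> b = 0"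
    and R: "R \<ge> 0"
  shows "real (card (lat_box q A B {c<..c+u} {\<alpha><..\<alpha>+R})) \<le> u * R / q + 2"
proof -
  let ?S = "lat_box q A B {c<..c+u} {\<alpha><..\<alpha>+R}"
  define f where "f = (\<lambda>(a,b). (u * b - v * a) div q)"
  \<comment> \<open>A lower bound for \<open>u * b - v * a\<close> on the strip. The values spread
    over at most \<open>u * R + \<bar>v\<bar> * u\<close>, and
    \<open>\<bar>v\<bar> * u \<le> u^2 \<le> q\<close>. This extra \<open>q\<close> allows one more
    line, which makes the additive constant 2 instead of 1.\<close>
  define L where "L = u * \<alpha> - v * c - max v 0 * u"
  have fq: "f (a,b) * q = u * b - v * a" if "(a,b) \<in> ?S" for a b
    using that lat_line_dvd[OF q(2) u(4)] by (auto simp: f_def lat_box_def)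
  have "inj_on f ?S"
  proof (rule inj_onI, clarify)
    fix a b a' b' assume S: "(a,b) \<in> ?S" "(a',b') \<in> ?S" and eq: "f (a,b) = f (a',b')"
    have *: "u * (b - b') = v * (a - a')"
      using fq[OF S(1)] fq[OF S(2)] eq by (simp add: algebra_simps)
    \<comment> \<open>The strip is half-open with \<open>u\<close> columns, so the inequality is
      strict, as minimality requires.\<close>
    have a: "\<bar>a - a'\<bar> < u" using S by (auto simp: lat_box_def)
    have "u * \<bar>b - b'\<bar> = \<bar>v\<bar> * \<bar>a - a'\<bar>"
      using * u by (metis abs_mult abs_of_pos)
    also have "\<dots> \<le> u * \<bar>a - a'\<bar>" using u by (intro mult_right_mono) auto
    finally have b: "\<bar>b - b'\<bar> < u" using a u by simp
    have "q dvd (a - a') * A - (b - b') * B"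
    proof -
      have "(a - a') * A - (b - b') * B = (a * A - b * B) - (a' * A - b' * B)"
        by (simp add: algebra_simps)
      then show ?thesis using S by (auto simp: lat_box_def)
    qed
    from min[OF this a b] show "a = a' \<and> b = b'" by simp
  qed
  then have "card ?S = card (f ` ?S)" by (simp add: card_image)
  also have "\<dots> \<le> card {j. L \<le> j * q \<and> j * q \<le> L + (u * R + q)}"
  proof (rule card_mono)
    show "finite {j. L \<le> j * q \<and> j * q \<le> L + (u * R + q)}"
      using card_multiples_le(1)[of q "u * R + q" L] q u R by simp
    show "f ` ?S \<subseteq> {j. L \<le> j * q \<and> j * q \<le> L + (u * R + q)}"
    proof (clarify)
      fix a b assume S: "(a,b) \<in> ?S"
      define i where "i = a - c"
      have i: "0 \<le> i" "i \<le> u" and b: "\<alpha> \<le> b" "b \<le> \<alpha> + R"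
        using S by (auto simp: lat_box_def i_def)
      have 1: "u * \<alpha> \<le> u * b" "u * b \<le> u * \<alpha> + u * R"
        using b u by (simp_all flip: distrib_left)
      have 2: "v * i \<le> max v 0 * u"
        using i u by (intro mult_mono) auto
      have "- (v * i) \<le> max (-v) 0 * u"
        unfolding minus_mult_left using i u by (intro mult_mono) auto
      moreover have "max (-v) 0 * u + max v 0 * u = \<bar>v\<bar> * u" by (auto simp: max_def)
      moreover have "\<bar>v\<bar> * u \<le> u^2" unfolding power2_eq_square using u by (intro mult_right_mono) auto
      ultimately have 3: "- (v * i) + max v 0 * u \<le> q" using u by linarith
      have "v * a = v * c + v * i" by (simp add: i_def algebra_simps)
      then show "L \<le> f (a,b) * q \<and> f (a,b) * q \<le> L + (u * R + q)"
        unfolding fq[OF S] L_def using 1 2 3 by linarith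
    qed
  qed
  also have "real \<dots> \<le> (u * R + q) / q + 1"
    using card_multiples_le(2)[of q "u * R + q" L] q u R by simp
  also have "\<dots> = u * R / q + 2" using q by (simp add: field_simps)
  finally show ?thesis by simp
qed

text \<open>Since \<open>B\<close> is a unit modulo \<open>q\<close>, a column \<open>a\<close>
  determines \<open>b\<close> modulo \<open>q\<close>, and \<open>{0<..q}\<close> is a complete
  residue system.\<close>

lemma card_lat_box_full:
  fixes q A B :: int
  assumes q: "q > 0" "coprime B q" and I: "finite I"
  shows "card (lat_box q A B I {0<..q}) = card I"
proof -
  have "bij_betw fst (lat_box q A B I {0<..q}) I"
  proof (rule bij_betw_imageI)
    show "inj_on fst (lat_box q A B I {0<..q})"
    proof (rule inj_onI, clarsimp simp: lat_box_def)
      fix a b b' assume b: "0 < b" "b \<le> q" "0 < b'" "b' \<le> q"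
        and "q dvd a * A - b * B" "q dvd a * A - b' * B"
      then have "q dvd (a * A - b' * B) - (a * A - b * B)" by (metis dvd_diff)
      then have "q dvd (b - b') * B" by (simp add: algebra_simps)
      then have "q dvd b - b'" using q by (metis coprime_commute coprime_dvd_mult_left_iff)
      moreover have "\<bar>b - b'\<bar> < q" using b by auto
      ultimately show "b = b'" using zdvd_imp_le[of q "\<bar>b - b'\<bar>"] by fastforce
    qed
    show "fst ` lat_box q A B I {0<..q} = I"
    proof (intro equalityI subsetI)
      fix a assume a: "a \<in> I"
      obtain B' where B': "[B * B' = 1] (mod q)" using q cong_solve_coprime_int by blast
      \<comment> \<open>The representative of \<open>a * A * B'\<close> in \<open>{0<..q}\<close>
        rather than in \<open>{0..<q}\<close>.\<close>
      define b where "b = q - (- (a * A * B')) mod q"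
      have b: "b \<in> {0<..q}" using q pos_mod_bound[of q] by (auto simp: b_def)
      have "[b = a * A * B'] (mod q)"
        by (simp add: b_def cong_def mod_simps)
      then have "[b * B = a * A * B' * B] (mod q)" by (rule cong_scalar_right)
      also have "[a * A * B' * B = a * A * 1] (mod q)"
        using cong_scalar_left[OF B', of "a * A"] by (simp add: mult_ac)
      finally have "q dvd a * A - b * B" by (metis cong_iff_dvd_diff cong_sym mult.right_neutral)
      with a b show "a \<in> fst ` lat_box q A B I {0<..q}" by (force simp: lat_box_def)
    qed (auto simp: lat_box_def)
  qed
  then show ?thesis by (rule bij_betw_same_card)
qed

lemma ivl_split:
  fixes a b :: int
  assumes "0 \<le> a" "a \<le> b"
  shows "{0<..b} = {0<..a} \<union> {a<..b}"
  using assms by auto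

lemma lat_box_block:
  fixes q A B u v c r :: int
  assumes q: "q > 0" "coprime B q" and u: "u > 0" "\<bar>v\<bar> \<le> u" "u^2 \<le> q" "q dvd u * A - v * B"
    and min: "\<And>a b. q dvd a * A - b * B \<Longrightarrow> \<bar>a\<bar> < u \<Longrightarrow> \<bar>b\<bar> < u \<Longrightarrow> a = 0 \<and> b = 0"
    and r: "0 \<le> r" "r \<le> q"
  shows "\<bar>real (card (lat_box q A B {c<..c+u} {0<..r})) - u * r / q\<bar> \<le> 2"
proof -
  let ?N = "\<lambda>J. card (lat_box q A B {c<..c+u} J)"
  \<comment> \<open>The lower bound is the upper bound for the complementary rows, since every column
    contains exactly one lattice point modulo q.\<close>
  have 1: "real (?N {0<..r}) \<le> u * r / q + 2"
    using lat_box_block_le[OF q u min, of r c 0] r by simp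
  have 2: "real (?N {r<..q}) \<le> u * (q - r) / q + 2"
    using lat_box_block_le[OF q u min, of "q - r" c r] r by simp
  have "{0<..q} = {0<..r} \<union> {r<..q}" "{0<..r} \<inter> {r<..q} = {}" using r by auto
  then have "?N {0<..r} + ?N {r<..q} = ?N {0<..q}"
    using card_lat_box_Un2[of "{0<..r}" "{r<..q}" "{c<..c+u}" q A B] by simp
  also have "\<dots> = nat u" using q by (simp add: card_lat_box_full)
  finally have "real (?N {0<..r}) + real (?N {r<..q}) = u"
    using u by (metis of_nat_add of_nat_nat order_less_imp_le of_int_of_nat_eq)
  moreover have "u * (q - r) / q = u - u * r / q" using q by (simp add: field_simps)
  ultimately show ?thesis using 1 2 unfolding abs_le_iff by (simp only:) simp
qed

lemma lat_box_blocks: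
  fixes q A B u v r :: int
  assumes q: "q > 0" "coprime B q" and u: "u > 0" "\<bar>v\<bar> \<le> u" "u^2 \<le> q" "q dvd u * A - v * B"
    and min: "\<And>a b. q dvd a * A - b * B \<Longrightarrow> \<bar>a\<bar> < u \<Longrightarrow> \<bar>b\<bar> < u \<Longrightarrow> a = 0 \<and> b = 0"
    and r: "0 \<le> r" "r \<le> q"
  shows "\<bar>real (card (lat_box q A B {0<..int n * u} {0<..r})) - n * u * r / q\<bar> \<le> 2 * n"
proof (induction n)
  case 0
  then show ?case by (simp add: lat_box_def)
next
  case (Suc n)
  have "0 \<le> int n * u" using u by simp
  then have "{0<..int (Suc n) * u} = {0<..int n * u} \<union> {int n * u<..int n * u + u}"
    using ivl_split[of "int n * u" "int n * u + u"] u by (simp add: algebra_simps)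
  then have "card (lat_box q A B {0<..int (Suc n) * u} {0<..r}) = 
      card (lat_box q A B {0<..int n * u} {0<..r}) + card (lat_box q A B {int n * u<..int n * u + u} {0<..r})"
    by (simp only:) (rule card_lat_box_Un1, auto)
  moreover have "\<bar>real (card (lat_box q A B {int n * u<..int n * u + u} {0<..r})) - u * r / q\<bar> \<le> 2"
    by (rule lat_box_block[OF q u min r])
  moreover have "real (Suc n) * u * r / q = n * u * r / q + u * r / q"
    by (simp add: algebra_simps add_divide_distrib)
  ultimately show ?case using Suc.IH by simp
qed

text \<open>There are \<open>n = r' div u\<close> full blocks and one incomplete block. Each full
  block errs by 2, in total at most \<open>2 * K / u\<close>. The incomplete one is only compared
  with the full block containing it: this costs \<open>u * r / q\<close>, at most
  \<open>K / u\<close> because \<open>u^2 \<le> q\<close>, and another 2, at most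
  \<open>2 * K / u\<close> because \<open>u \<le> K\<close>. The sum is the constant 5.\<close>

lemma lat_box_strip:
  fixes q A B u v r r' K :: int
  assumes q: "q > 0" "coprime B q" and u: "u > 0" "\<bar>v\<bar> \<le> u" "u^2 \<le> q" "q dvd u * A - v * B"
    and min: "\<And>a b. q dvd a * A - b * B \<Longrightarrow> \<bar>a\<bar> < u \<Longrightarrow> \<bar>b\<bar> < u \<Longrightarrow> a = 0 \<and> b = 0"
    and r: "0 \<le> r" "r \<le> K" "0 \<le> r'" "r' \<le> K" "K \<le> q" "u \<le> K"
  shows "\<bar>real (card (lat_box q A B {0<..r'} {0<..r})) - r' * r / q\<bar> \<le> 5 * K / u"
proof -
  define n where "n = nat (r' div u)"
  define s where "s = r' mod u"
  have n: "int n = r' div u" using r u by (simp add: n_def pos_imp_zdiv_nonneg_iff)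
  have s: "0 \<le> s" "s < u" using u by (auto simp: s_def)
  have r'_eq: "r' = int n * u + s" unfolding n s_def by simp
  let ?N = "\<lambda>I. real (card (lat_box q A B I {0<..r}))"
  have nu: "0 \<le> int n * u" using u by simp
  have "{0<..r'} = {0<..int n * u} \<union> {int n * u<..r'}"
    using r'_eq nu s by (intro ivl_split) auto
  then have N: "?N {0<..r'} = ?N {0<..int n * u} + ?N {int n * u<..r'}"
    by (simp only:) (subst card_lat_box_Un1, auto)
  have "r \<le> q" using r by simp
  then have 1: "\<bar>?N {0<..int n * u} - n * u * r / q\<bar> \<le> 2 * real n"
    using lat_box_blocks[OF q u min r(1), of n] by simp
  have "?N {int n * u<..r'} \<le> ?N {int n * u<..int n * u + u}"
    using r'_eq s by (intro of_nat_mono card_mono finite_lat_box) (auto simp: lat_box_def)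
  also have "\<dots> \<le> u * r / q + 2"
    using lat_box_block[OF q u min r(1) \<open>r \<le> q\<close>, of "int n * u"] by linarith
  finally have 2: "?N {int n * u<..r'} \<le> u * r / q + 2" .
  have 3: "r' * r / q = n * u * r / q + s * r / q"
    by (subst r'_eq) (simp add: algebra_simps add_divide_distrib)
  have "real_of_int (s * r) \<le> u * r" using s r by (simp add: mult_right_mono)
  then have 4: "0 \<le> s * r / q" "s * r / q \<le> u * r / q"
    using s r q by (auto simp: divide_right_mono)
  have 5: "u * r / q \<le> K / u"
  proof -
    have "u^2 * r \<le> q * K"
      using u r q by (intro mult_mono) auto
    then have "real_of_int (u^2 * r) \<le> q * K"
      by (simp only: of_int_le_iff)
    then show ?thesis using u q by (simp add: field_simps power2_eq_square)
  qed
  have 6: "real n \<le> K / u"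
  proof -
    have "int n * u \<le> K" using r'_eq s r by linarith
    then have "real n * u \<le> K" by (metis of_int_le_iff of_int_mult of_int_of_nat_eq)
    then show ?thesis using u by (simp add: field_simps)
  qed
  have 7: "1 \<le> K / u" using r u by (simp add: field_simps)
  have "5 * K / u = 5 * (K / u)" by simp
  then show ?thesis
    using 1 2 3 4 5 6 7 N by linarith
qed

section \<open>Shortest lattice vectors and the lattice points of a box\<close>

text \<open>The first minimum of the lattice in the sup norm, the norm adapted to boxes. For
  \<open>q > 0\<close> the \<open>LEAST\<close> ranges over a nonempty set by
  \<open>thue\<close>.\<close>

definition minlen :: "int \<Rightarrow> int \<Rightarrow> int \<Rightarrow> nat" where
  "minlen q A B = (LEAST m. \<exists>u v. (u, v) \<noteq> (0, 0) \<and> \<bar>u\<bar> \<le> int m \<and> \<bar>v\<bar> \<le> int m \<and> q dvd u * A - v * B)"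

text \<open>Thue's lemma: with \<open>m\<close> the integer part of \<open>sqrt q\<close>, there are
  \<open>(m + 1)^2 > q\<close> pairs with coordinates in \<open>{0..m}\<close>, so two of them agree
  in \<open>a * A - b * B\<close> modulo \<open>q\<close>; their difference is the required
  vector.\<close>

lemma thue:
  fixes q A B :: int
  assumes "q > 0"
  shows "\<exists>m. (int m)^2 \<le> q \<and> (\<exists>u v. (u, v) \<noteq> (0, 0) \<and> \<bar>u\<bar> \<le> int m \<and> \<bar>v\<bar> \<le> int m \<and> q dvd u * A - v * B)"
proof -
  define m where "m = nat \<lfloor>sqrt q\<rfloor>"
  have m: "int m = \<lfloor>sqrt q\<rfloor>" using assms by (simp add: m_def)
  have "real_of_int \<lfloor>sqrt q\<rfloor> ^ 2 \<le> sqrt q ^ 2" using assms by (intro power_mono) auto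
  then have m1: "(int m)^2 \<le> q" using assms unfolding m
    by (metis of_int_0_le_iff of_int_le_iff of_int_power order_less_imp_le real_sqrt_pow2)
  have "sqrt q ^ 2 < (real_of_int \<lfloor>sqrt q\<rfloor> + 1) ^ 2" using assms by (intro power_strict_mono) auto
  then have "real_of_int q < of_int ((int m + 1)^2)" using assms unfolding m by simp
  then have m2: "q < (int m + 1)^2" by (simp only: of_int_less_iff)
  let ?S = "{0..int m} \<times> {0..int m}"
  let ?f = "\<lambda>(a, b). (a * A - b * B) mod q"
  have "card (?f ` ?S) \<le> card {0..<q}"
    using assms by (intro card_mono) auto
  also have "\<dots> < card ?S" using m2 assms
    by (simp add: card_cartesian_product power2_eq_square nat_less_iff nat_mult_distrib)
  finally have "\<not> inj_on ?f ?S" by (rule pigeonhole)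
  then obtain a b a' b' where S: "(a,b) \<in> ?S" "(a',b') \<in> ?S" "(a,b) \<noteq> (a',b')"
      and eq: "(a * A - b * B) mod q = (a' * A - b' * B) mod q"
    by (auto simp: inj_on_def)
  have "q dvd (a * A - b * B) - (a' * A - b' * B)" using eq by (simp add: mod_eq_dvd_iff)
  then have "q dvd (a - a') * A - (b - b') * B" by (simp add: algebra_simps)
  moreover have "(a - a', b - b') \<noteq> (0,0)" "\<bar>a - a'\<bar> \<le> int m" "\<bar>b - b'\<bar> \<le> int m" using S by auto
  ultimately have "\<exists>u v. (u, v) \<noteq> (0, 0) \<and> \<bar>u\<bar> \<le> int m \<and> \<bar>v\<bar> \<le> int m \<and> q dvd u * A - v * B"
    by (rule_tac exI[of _ "a - a'"], rule_tac exI[of _ "b - b'"]) (intro conjI)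
  with m1 show ?thesis by (intro exI[of _ m] conjI)
qed

lemma minlen_props:
  fixes q A B :: int
  assumes "q > 0"
  shows minlen_attained: "\<exists>u v. (u, v) \<noteq> (0, 0) \<and> max \<bar>u\<bar> \<bar>v\<bar> = int (minlen q A B) \<and> q dvd u * A - v * B"
    and minlen_sq_le: "(int (minlen q A B))^2 \<le> q"
    and minlen_pos: "minlen q A B > 0"
    and minlen_minimal: "\<And>a b. q dvd a * A - b * B \<Longrightarrow> \<bar>a\<bar> < int (minlen q A B) \<Longrightarrow>
           \<bar>b\<bar> < int (minlen q A B) \<Longrightarrow> a = 0 \<and> b = 0"
proof -
  define P where "P m \<longleftrightarrow> (\<exists>u v. (u, v) \<noteq> (0, 0) \<and> \<bar>u\<bar> \<le> int m \<and> \<bar>v\<bar> \<le> int m \<and> q dvd u * A - v * B)" for m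
  have minlen_eq: "minlen q A B = (LEAST m. P m)" by (simp add: minlen_def P_def)
  obtain m0 where m0: "(int m0)^2 \<le> q" "P m0"
    using thue[OF assms, of A B] unfolding P_def by metis
  have "P (minlen q A B)" unfolding minlen_eq using m0(2) by (rule LeastI)
  then obtain u v where uv: "(u, v) \<noteq> (0, 0)" "\<bar>u\<bar> \<le> int (minlen q A B)" "\<bar>v\<bar> \<le> int (minlen q A B)"
      "q dvd u * A - v * B" unfolding P_def by (elim exE conjE) (rule that)
  have least: "minlen q A B \<le> m" if "P m" for m unfolding minlen_eq using that by (rule Least_le)
  have ge: "int (minlen q A B) \<le> max \<bar>a\<bar> \<bar>b\<bar>" if "(a, b) \<noteq> (0, 0)" "q dvd a * A - b * B" for a b
  proof -
    have "minlen q A B \<le> nat (max \<bar>a\<bar> \<bar>b\<bar>)"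
      by (rule least, unfold P_def, rule exI[of _ a], rule exI[of _ b]) (use that in \<open>auto simp: max_def\<close>)
    then show ?thesis by simp
  qed
  show "\<exists>u v. (u, v) \<noteq> (0, 0) \<and> max \<bar>u\<bar> \<bar>v\<bar> = int (minlen q A B) \<and> q dvd u * A - v * B"
    using uv ge[of u v] by (intro exI[of _ u] exI[of _ v]) auto
  show "minlen q A B > 0" using uv by (cases "minlen q A B") auto
  have "int (minlen q A B) \<le> int m0" using least m0 by simp
  then have "(int (minlen q A B))^2 \<le> (int m0)^2" by (intro power_mono) auto
  from this m0(1) show "(int (minlen q A B))^2 \<le> q" by (rule order_trans)
  show "a = 0 \<and> b = 0" if "q dvd a * A - b * B" "\<bar>a\<bar> < int (minlen q A B)" "\<bar>b\<bar> < int (minlen q A B)" for a b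
    using ge[of a b] that by fastforce
qed

text \<open>If \<open>K\<close> is below the minimal length \<open>m\<close>, the box contains no
  lattice point, and \<open>m^2 \<le> q\<close> puts the main term itself below the bound. Otherwise
  a shortest vector is brought, by a change of sign and if necessary an exchange of coordinates, to
  the form with first coordinate \<open>m\<close> that \<open>lat_box_strip\<close> treats. The
  exchange turns the condition on \<open>B\<close> into one on \<open>A\<close>.\<close>

lemma lat_box_count:
  fixes q A B r r' K :: int
  assumes q: "q > 0" "coprime A q" "coprime B q"
    and r: "0 \<le> r" "r \<le> K" "0 \<le> r'" "r' \<le> K" "K \<le> q"
  shows "\<bar>real (card (lat_box q A B {0<..r} {0<..r'})) - r * r' / q\<bar> \<le> 5 * K / minlen q A B"
proof -
  define m where "m = int (minlen q A B)"
  have m_pos: "m > 0" and m_sq: "m^2 \<le> q"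
    and m_min: "\<And>a b. q dvd a * A - b * B \<Longrightarrow> \<bar>a\<bar> < m \<Longrightarrow> \<bar>b\<bar> < m \<Longrightarrow> a = 0 \<and> b = 0"
    using minlen_pos[OF q(1)] minlen_sq_le[OF q(1)] minlen_minimal[OF q(1)] by (auto simp: m_def)
  show ?thesis
  proof (cases "K < m")
    case True
    have "lat_box q A B {0<..r} {0<..r'} = {}"
      using m_min True r by (force simp: lat_box_def)
    moreover have "real_of_int r * r' / q \<le> 5 * K / m"
    proof -
      have "m * r * r' \<le> m * K * m"
        using r True m_pos by (intro mult_mono) auto
      also have "\<dots> = m^2 * K" by (simp add: power2_eq_square)
      also have "\<dots> \<le> q * K" using m_sq r by (intro mult_right_mono) auto
      also have "\<dots> \<le> 5 * K * q" using r q by simp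
      finally have "real_of_int (m * r * r') \<le> real_of_int (5 * K * q)" by (simp only: of_int_le_iff)
      then show ?thesis using m_pos q by (simp add: field_simps)
    qed
    moreover have "real_of_int r * r' / q \<ge> 0" using r q by simp
    ultimately show ?thesis by (simp add: m_def)
  next
    case False
    then have mK: "m \<le> K" by simp
    obtain u v where uv: "max \<bar>u\<bar> \<bar>v\<bar> = m" "q dvd u * A - v * B"
      using minlen_attained[OF q(1)] unfolding m_def by blast
    have uv': "q dvd - u * A - (- v) * B"
      using uv(2) dvd_minus_iff[of q "u * A - v * B"] by (simp add: algebra_simps)
    show ?thesis
    proof (cases "\<bar>u\<bar> = m")
      case True
      obtain u' v' where u': "u' = m" "\<bar>v'\<bar> \<le> m" "q dvd u' * A - v' * B"
      proof (cases "u \<ge> 0")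
        case u0: True
        show ?thesis by (rule that[of u v]) (use uv True u0 in auto)
      next
        case u0: False
        show ?thesis by (rule that[OF _ _ uv']) (use uv True u0 in auto)
      qed
      from lat_box_strip[OF q(1,3) _ _ _ u'(3) _ r(3,4,1,2,5), unfolded u'(1), OF m_pos u'(2) m_sq m_min mK]
      show ?thesis by (simp add: m_def)
    next
      case False
      then have "\<bar>v\<bar> = m" "\<bar>u\<bar> \<le> m" using uv by (auto simp: max_def split: if_splits)
      then obtain u' v' where v': "v' = m" "\<bar>u'\<bar> \<le> m" "q dvd v' * B - u' * A"
      proof (cases "v \<ge> 0")
        case v0: True
        show ?thesis by (rule that[of v u]) (use uv(2) \<open>\<bar>v\<bar> = m\<close> \<open>\<bar>u\<bar> \<le> m\<close> v0 in \<open>auto simp: dvd_diff_commute\<close>)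
      next
        case v0: False
        have "q dvd (- v) * B - (- u) * A" using uv' by (subst dvd_diff_commute)
        then show ?thesis by (rule that[rotated 2]) (use \<open>\<bar>v\<bar> = m\<close> \<open>\<bar>u\<bar> \<le> m\<close> v0 in auto)
      qed
      have min': "q dvd a * B - b * A \<Longrightarrow> \<bar>a\<bar> < m \<Longrightarrow> \<bar>b\<bar> < m \<Longrightarrow> a = 0 \<and> b = 0" for a b
        using m_min[of b a] by (simp add: dvd_diff_commute)
      from lat_box_strip[OF q(1,2) _ _ _ v'(3) _ r(1-5), unfolded v'(1), OF m_pos v'(2) m_sq min' mK]
      have "\<bar>real (card (lat_box q B A {0<..r'} {0<..r})) - r' * r / q\<bar> \<le> 5 * K / m" .
      moreover have "card (lat_box q A B {0<..r} {0<..r'}) = card (lat_box q B A {0<..r'} {0<..r})"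
        by (rule lat_box_swap)
      ultimately show ?thesis by (simp only: m_def of_int_of_nat_eq mult.commute[of r r'])
    qed
  qed
qed

section \<open>Sums over reciprocal lengths of shortest vectors\<close>

lemma card_separated_le:
  fixes S :: "real set"
  assumes fin: "finite S" and \<eta>: "\<eta> > 0" and sub: "S \<subseteq> {0..1}"
    and sep: "\<And>x y. x \<in> S \<Longrightarrow> y \<in> S \<Longrightarrow> x \<noteq> y \<Longrightarrow> \<bar>x - y\<bar> \<ge> \<eta>"
  shows "real (card S) \<le> 1 + 1 / \<eta>"
proof -
  let ?f = "\<lambda>x. \<lfloor>x / \<eta>\<rfloor>"
  have "inj_on ?f S"
  proof (rule inj_onI, rule ccontr)
    fix x y assume xy: "x \<in> S" "y \<in> S" "\<lfloor>x / \<eta>\<rfloor> = \<lfloor>y / \<eta>\<rfloor>" "x \<noteq> y"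
    then have "\<bar>x / \<eta> - y / \<eta>\<bar> < 1" by linarith
    then have "\<bar>x - y\<bar> / \<eta> < 1" using \<eta> by (simp flip: diff_divide_distrib add: abs_divide)
    with sep[OF xy(1,2,4)] \<eta> show False by simp
  qed
  then have "card S = card (?f ` S)" by (simp add: card_image)
  also have "\<dots> \<le> card {0..\<lfloor>1 / \<eta>\<rfloor>}"
  proof (rule card_mono, simp, clarify)
    fix x assume "x \<in> S"
    with sub have "0 \<le> x" "x \<le> 1" by auto
    with \<eta> show "\<lfloor>x / \<eta>\<rfloor> \<in> {0..\<lfloor>1 / \<eta>\<rfloor>}" by (auto intro!: floor_mono divide_right_mono)
  qed
  also have "real \<dots> \<le> 1 + 1 / \<eta>" using \<eta> by (simp add: of_nat_nat)
  finally show ?thesis by simp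
qed

lemma coprime_pair_eqI:
  fixes a b c d :: int
  assumes "coprime a b" "coprime c d" "a > 0" "b > 0" "c > 0" "d > 0" "a * d = c * b"
  shows "a = c \<and> b = d"
proof -
  have "a dvd c * b" "c dvd a * d" by (metis assms(7) dvd_triv_left)+
  then have "a dvd c" "c dvd a"
    using assms(1,2) by (simp_all add: coprime_dvd_mult_left_iff)
  then have "a = c" using assms by (simp add: zdvd_antisym_nonneg)
  with assms show ?thesis by auto
qed

text \<open>Read as fractions, two pairs are at distance
  \<open>\<bar>a * d - c * b\<bar> / (b * d)\<close>, hence at least \<open>\<delta> / R^2\<close>,
  and points of the unit interval are counted by their spacing. Fractions above 1 are inverted
  first, whence the factor 2.\<close>

lemma card_coprime_pairs_separated:
  fixes P :: "(int \<times> int) set" and R :: int and \<delta> :: real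
  assumes fin: "finite P" and \<delta>: "\<delta> > 0" and R: "R > 0"
    and P: "\<And>a b. (a, b) \<in> P \<Longrightarrow> 0 < a \<and> a \<le> R \<and> 0 < b \<and> b \<le> R \<and> coprime a b"
    and sep: "\<And>a b c d. (a, b) \<in> P \<Longrightarrow> (c, d) \<in> P \<Longrightarrow> (a, b) \<noteq> (c, d) \<Longrightarrow> \<delta> \<le> real_of_int \<bar>a * d - c * b\<bar>"
  shows "real (card P) \<le> 2 * (1 + R^2 / \<delta>)"
proof -
  define P1 where "P1 = {p \<in> P. fst p \<le> snd p}"
  define P2 where "P2 = {p \<in> P. snd p < fst p}"
  have eta: "\<delta> / R^2 > 0" using \<delta> R by simp
  have gen: "real (card Q) \<le> 1 + R^2 / \<delta>"
    if Q: "finite Q" "\<And>a b. (a, b) \<in> Q \<Longrightarrow> 0 < a \<and> a \<le> b \<and> b \<le> R \<and> coprime a b"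
      "\<And>a b c d. (a, b) \<in> Q \<Longrightarrow> (c, d) \<in> Q \<Longrightarrow> (a, b) \<noteq> (c, d) \<Longrightarrow> \<delta> \<le> real_of_int \<bar>a * d - c * b\<bar>"
    for Q :: "(int \<times> int) set"
  proof -
    let ?f = "\<lambda>(a, b). real_of_int a / real_of_int b"
    have dist: "\<delta> / R^2 \<le> \<bar>a / b - c / d\<bar>" if "(a, b) \<in> Q" "(c, d) \<in> Q" "(a, b) \<noteq> (c, d)" for a b c d
    proof -
      have bd: "0 < b" "0 < d" "b \<le> R" "d \<le> R" using Q(2)[OF that(1)] Q(2)[OF that(2)] by auto
      then have "real_of_int (b * d) \<le> of_int (R * R)"
        using R by (simp only: of_int_le_iff) (intro mult_mono, auto)
      then have "\<delta> / R^2 \<le> \<delta> / (b * d)"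
        using \<delta> bd by (intro divide_left_mono) (auto simp: power2_eq_square R)
      also have "\<dots> \<le> \<bar>a * d - c * b\<bar> / (b * d)"
        using Q(3)[OF that] bd by (intro divide_right_mono) auto
      also have "\<dots> = \<bar>a / b - c / d\<bar>"
        using bd by (simp add: field_simps abs_mult abs_divide)
      finally show ?thesis .
    qed
    have inj: "inj_on ?f Q"
    proof (rule inj_onI, clarify, rule ccontr)
      fix a b c d assume *: "(a, b) \<in> Q" "(c, d) \<in> Q" "real_of_int a / b = c / d" "\<not> (a = c \<and> b = d)"
      then show False using dist[of a b c d] eta by auto
    qed
    then have "card Q = card (?f ` Q)" by (simp add: card_image)
    also have "real \<dots> \<le> 1 + 1 / (\<delta> / R^2)"
    proof (rule card_separated_le)
      show "?f ` Q \<subseteq> {0..1}" using Q(2) by (force simp: divide_le_eq)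
      show "\<delta> / R^2 \<le> \<bar>x - y\<bar>" if "x \<in> ?f ` Q" "y \<in> ?f ` Q" "x \<noteq> y" for x y
        using that dist by fastforce
    qed (use eta Q(1) in auto)
    finally show ?thesis by simp
  qed
  have 1: "real (card P1) \<le> 1 + R^2 / \<delta>"
    by (rule gen) (use fin P sep in \<open>auto simp: P1_def\<close>)
  have 2: "real (card (prod.swap ` P2)) \<le> 1 + R^2 / \<delta>"
  proof (rule gen, goal_cases)
    case 1
    then show ?case using fin by (simp add: P2_def)
  next
    case (2 a b)
    then show ?case using P[of b a] by (auto simp: P2_def coprime_commute)
  next
    case (3 a b c d)
    then show ?case using sep[of b a d c] by (auto simp: P2_def abs_minus_commute mult.commute)
  qed
  have "card (prod.swap ` P2) = card P2" by (rule card_image) (auto simp: inj_on_def)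
  moreover have "P = P1 \<union> P2" by (auto simp: P1_def P2_def)
  then have "card P \<le> card P1 + card P2" by (simp add: card_Un_le)
  ultimately show ?thesis using 1 2 by simp
qed

text \<open>Fix one solution f. Every solution (a, b) satisfies a f2 = b f1 modulo g and a f2 = - b f1
  modulo Q / g, where Q = q / gcd u q and g = gcd Q (a f2 - b f1). So the solutions fall into at most
  as many classes as q has divisors, and two solutions in one class have a determinant that is
  divisible by Q up to a factor 2. Their slopes are then far apart.\<close>

lemma card_square_congruence:
  fixes q u v R :: int
  assumes q: "q > 0" and u: "u > 0" and R: "R > 0"
  shows "real (card {(a, b). 0 < a \<and> a \<le> R \<and> 0 < b \<and> b \<le> R \<and> coprime a b \<and> coprime a q \<and>
            coprime b q \<and> q dvd u * a^2 - v * b^2})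
          \<le> real (card {d. d dvd q \<and> d > 0}) * (2 * (1 + 2 * R^2 * gcd u q / q))"
    (is "real (card ?P) \<le> _")
proof (cases "?P = {}")
  case True
  then show ?thesis using q by (simp only: card.empty) (auto intro!: mult_nonneg_nonneg divide_nonneg_nonneg add_nonneg_nonneg)
next
  case False
  then obtain f1 f2 where f: "(f1, f2) \<in> ?P" by auto
  define e where "e = gcd u q"
  define Q where "Q = q div e"
  have e: "e > 0" using q by (simp add: e_def)
  have qQ: "q = Q * e" by (simp add: Q_def e_def)
  have Qpos: "Q > 0" using q e qQ by (metis zero_less_mult_pos2)
  have Qq: "Q dvd q" using qQ by simp
  have finP: "finite ?P" by (rule finite_subset[of _ "{0..R} \<times> {0..R}"]) auto
  define D where "D = {d. d dvd q \<and> d > 0}"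
  have finD: "finite D" using q by (auto simp: D_def intro: finite_subset[OF _ finite_divisors_int[of q]])
  define h where "h = (\<lambda>(a, b). gcd Q (a * f2 - b * f1))"
  have coQ: "coprime x Q" if "coprime x q" for x using that Qq by (metis coprime_divisors dvd_refl)
  have key: "Q dvd 2 * (a * d - c * b)"
    if S: "(a, b) \<in> ?P" "(c, d) \<in> ?P" and h: "h (a, b) = h (c, d)" for a b c d
  proof -
    have Qdvd: "Q dvd (a * f2 - b * f1) * (a * f2 + b * f1)" if "(a, b) \<in> ?P" for a b
    proof -
      \<comment> \<open>This eliminates \<open>v\<close> between the congruence for
        \<open>(a, b)\<close> and the one for the fixed solution; the difference of squares then
        factors.\<close>
      have "q dvd f2^2 * (u * a^2 - v * b^2) - b^2 * (u * f1^2 - v * f2^2)"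
        using that f by (auto intro: dvd_diff[OF dvd_mult dvd_mult])
      also have "\<dots> = u * ((a * f2 - b * f1) * (a * f2 + b * f1))"
        by (simp add: algebra_simps power2_eq_square)
      finally have "q dvd u * ((a * f2 - b * f1) * (a * f2 + b * f1))" .
      moreover define u' where "u' = u div e"
      have u': "u = u' * e" "coprime u' Q"
        using u by (auto simp: u'_def Q_def e_def intro: div_gcd_coprime)
      ultimately have "Q * e dvd (u' * ((a * f2 - b * f1) * (a * f2 + b * f1))) * e"
        using qQ by (simp add: mult_ac)
      then have "Q dvd u' * ((a * f2 - b * f1) * (a * f2 + b * f1))"
        using e by simp
      with u'(2) show ?thesis
        by (metis coprime_commute coprime_dvd_mult_right_iff)
    qed
    define g where "g = h (a, b)"
    have gQ: "g dvd Q" by (simp add: g_def h_def)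
    define g' where "g' = Q div g"
    have Qg: "Q = g * g'" using gQ by (simp add: g'_def)
    have gpos: "g > 0" using Qpos by (simp add: g_def h_def)
    have minus: "g dvd a * f2 - b * f1" "g dvd c * f2 - d * f1"
      using h by (simp_all add: g_def h_def) (metis gcd_dvd2)
    have plus: "g' dvd a * f2 + b * f1" if "(a, b) \<in> ?P" "h (a, b) = g" for a b
    proof -
      let ?X = "a * f2 - b * f1"
      define X' where "X' = ?X div g"
      have g_eq: "g = gcd Q ?X" using that by (simp add: h_def)
      have X': "?X = X' * g" by (simp add: g_eq X'_def)
      have "coprime g' X'" unfolding g'_def X'_def g_eq using Qpos by (intro div_gcd_coprime) auto
      moreover have "g * g' dvd g * (X' * (a * f2 + b * f1))"
        using Qdvd[OF that(1)] unfolding X' Qg by (simp add: mult_ac)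
      then have "g' dvd X' * (a * f2 + b * f1)" using gpos by simp
      ultimately show ?thesis by (metis coprime_commute coprime_dvd_mult_right_iff)
    qed
    have cof: "coprime f2 Q" using f coQ by auto
    have 1: "g dvd a * d - c * b"
    proof -
      have "g dvd d * (a * f2 - b * f1) - b * (c * f2 - d * f1)"
        using minus by (auto intro: dvd_diff[OF dvd_mult dvd_mult])
      also have "\<dots> = f2 * (a * d - c * b)" by (simp add: algebra_simps)
      finally show ?thesis using cof gQ
        by (metis coprime_commute coprime_divisors coprime_dvd_mult_right_iff dvd_refl)
    qed
    have 2: "g' dvd a * d - c * b"
    proof -
      have "g' dvd d * (a * f2 + b * f1) - b * (c * f2 + d * f1)"
        using plus[OF S(1)] plus[OF S(2)] h g_def by (auto intro: dvd_diff[OF dvd_mult dvd_mult])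
      also have "\<dots> = f2 * (a * d - c * b)" by (simp add: algebra_simps)
      finally show ?thesis using cof Qg
        by (metis coprime_commute coprime_divisors coprime_dvd_mult_right_iff dvd_refl dvd_triv_right)
    qed
    \<comment> \<open>\<open>g\<close> and \<open>g'\<close> need not be coprime, but their gcd
      divides \<open>2 * (a * f2)\<close> with \<open>a * f2\<close> coprime to \<open>Q\<close>, so
      it divides 2. This is the origin of the factor 2 in \<open>key\<close>.\<close>
    have "gcd g g' dvd (a * f2 - b * f1) + (a * f2 + b * f1)"
      using dvd_trans[OF gcd_dvd1 minus(1)] dvd_trans[OF gcd_dvd2 plus[OF S(1) g_def[symmetric]]]
      by (rule dvd_add)
    then have "gcd g g' dvd (a * f2) * 2" by (simp add: mult.commute)
    moreover have "coprime (a * f2) Q" using S(1) cof coQ by auto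
    then have "coprime (gcd g g') (a * f2)"
      using gQ by (metis coprime_commute coprime_divisors dvd_refl dvd_trans gcd_dvd1)
    ultimately have "gcd g g' dvd 2" by (metis coprime_dvd_mult_right_iff)
    then have "lcm g g' * gcd g g' dvd (a * d - c * b) * 2"
      using 1 2 by (intro mult_dvd_mono) auto
    moreover have "lcm g g' * gcd g g' = \<bar>g * g'\<bar>" by (simp add: prod_gcd_lcm_int[symmetric] mult.commute abs_mult)
    ultimately show ?thesis using Qpos Qg by (simp add: mult.commute)
  qed
  have fib: "real (card {p \<in> ?P. h p = g}) \<le> 2 * (1 + R^2 / (Q / 2))" for g
  proof (rule card_coprime_pairs_separated[OF _ _ R])
    fix a b c d
    assume S: "(a, b) \<in> {p \<in> ?P. h p = g}" "(c, d) \<in> {p \<in> ?P. h p = g}" "(a, b) \<noteq> (c, d)"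
    then have "Q dvd 2 * (a * d - c * b)" by (intro key) auto
    moreover have "a * d - c * b \<noteq> 0" using coprime_pair_eqI[of a b c d] S by auto
    ultimately have "Q \<le> \<bar>2 * (a * d - c * b)\<bar>" by (intro zdvd_imp_le) auto
    then have "Q \<le> 2 * \<bar>a * d - c * b\<bar>" by (simp only: abs_mult)
    then have "real_of_int Q \<le> real_of_int (2 * \<bar>a * d - c * b\<bar>)" by (simp only: of_int_le_iff)
    then show "Q / 2 \<le> real_of_int \<bar>a * d - c * b\<bar>" by simp
  qed (use finP Qpos in auto)
  have "card ?P \<le> (\<Sum>g\<in>D. card {p \<in> ?P. h p = g})"
  proof -
    have "?P = (\<Union>g\<in>D. {p \<in> ?P. h p = g})"
    proof (intro equalityI subsetI)
      fix p assume p: "p \<in> ?P"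
      have "h p dvd Q" "h p > 0" using Qpos by (auto simp: h_def split: prod.splits)
      then have "h p \<in> D" using Qq by (auto simp: D_def)
      with p show "p \<in> (\<Union>g\<in>D. {p \<in> ?P. h p = g})" by blast
    qed blast
    then have "card ?P = card (\<Union>g\<in>D. {p \<in> ?P. h p = g})" by (rule arg_cong)
    also have "\<dots> \<le> (\<Sum>g\<in>D. card {p \<in> ?P. h p = g})" by (rule card_UN_le[OF finD])
    finally show ?thesis .
  qed
  then have "real (card ?P) \<le> (\<Sum>g\<in>D. real (card {p \<in> ?P. h p = g}))"
    by (simp only: of_nat_sum[symmetric] of_nat_le_iff)
  also have "\<dots> \<le> (\<Sum>g\<in>D. 2 * (1 + R^2 / (Q / 2)))" by (intro sum_mono fib)
  also have "\<dots> = real (card D) * (2 * (1 + R^2 / (Q / 2)))" by simp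
  also have "R^2 / (Q / 2) = 2 * R^2 * e / q" using e Qpos by (simp add: qQ)
  finally show ?thesis by (simp add: D_def e_def)
qed

section \<open>Averages of the reciprocal minimal length\<close>

lemma harm_le_ln: "n > 0 \<Longrightarrow> harm n \<le> 1 + ln (real n)"
  using euler_mascheroni_sequence_decreasing[of 1 n] by (simp add: harm_expand)

text \<open>\<open>gcd u q\<close> is at most the sum of all common divisors \<open>e\<close> of
  \<open>u\<close> and \<open>q\<close>. After exchanging the sums, each divisor \<open>e\<close> of
  \<open>q\<close> contributes \<open>e\<close> for each of its at most \<open>N / e\<close>
  multiples, so at most \<open>N\<close>.\<close>

lemma sum_gcd_le:
  fixes q :: int and N :: nat
  assumes q: "q > 0"
  shows "(\<Sum>u\<in>{0<..int N}. real_of_int (gcd u q)) \<le> N * real (card {d. d dvd q \<and> d > 0})"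
proof -
  let ?D = "{d. d dvd q \<and> d > 0}"
  have finD: "finite ?D" using q by (auto intro: finite_subset[OF _ finite_divisors_int[of q]])
  have "(\<Sum>u\<in>{0<..int N}. real_of_int (gcd u q)) \<le> (\<Sum>u\<in>{0<..int N}. \<Sum>e\<in>?D. if e dvd u then real_of_int e else 0)"
  proof (rule sum_mono)
    fix u assume "u \<in> {0<..int N}"
    have "real_of_int (gcd u q) = (\<Sum>e\<in>{gcd u q}. if e dvd u then real_of_int e else 0)" by simp
    also have "\<dots> \<le> (\<Sum>e\<in>?D. if e dvd u then real_of_int e else 0)"
      using finD q by (intro sum_mono2) auto
    finally show "real_of_int (gcd u q) \<le> \<dots>" .
  qed
  also have "\<dots> = (\<Sum>e\<in>?D. \<Sum>u\<in>{0<..int N}. if e dvd u then real_of_int e else 0)"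
    by (rule sum.swap)
  also have "\<dots> \<le> (\<Sum>e\<in>?D. real N)"
  proof (rule sum_mono)
    fix e assume "e \<in> ?D"
    then have e: "e > 0" by simp
    have "{u\<in>{0<..int N}. e dvd u} \<subseteq> (\<lambda>k. e * k) ` {0<..int N div e}"
    proof clarify
      fix u assume u: "u \<in> {0<..int N}" "e dvd u"
      then obtain k where k: "u = e * k" by blast
      have "(e * k) div e \<le> int N div e" using u e unfolding k by (intro zdiv_mono1) auto
      then have "k \<in> {0<..int N div e}"
        using u e unfolding k by (auto simp: zero_less_mult_iff)
      then show "u \<in> (\<lambda>k. e * k) ` {0<..int N div e}" using k by blast
    qed
    then have "card {u\<in>{0<..int N}. e dvd u} \<le> card {0<..int N div e}"
      by (meson card_image_le card_mono finite_greaterThanAtMost_int finite_imageI le_trans)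
    also have "\<dots> = nat (int N div e)" by simp
    finally have "int (card {u\<in>{0<..int N}. e dvd u}) \<le> int N div e"
      using e by (simp add: pos_imp_zdiv_nonneg_iff le_nat_iff)
    then have "e * int (card {u\<in>{0<..int N}. e dvd u}) \<le> e * (int N div e)"
      using e by (intro mult_left_mono) auto
    also have "\<dots> \<le> int N" using e pos_mod_sign[OF e, of "int N"] mult_div_mod_eq[of e "int N"] by linarith
    finally have "real_of_int (e * int (card {u\<in>{0<..int N}. e dvd u})) \<le> real_of_int (int N)"
      by (simp only: of_int_le_iff)
    then show "(\<Sum>u\<in>{0<..int N}. if e dvd u then real_of_int e else 0) \<le> real N"
      by (simp add: sum.If_cases Int_def mult.commute conj_commute)
  qed
  also have "\<dots> = N * real (card ?D)" by simp
  finally show ?thesis .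
qed

text \<open>In the constant 9 the long vectors account for 1 and the short ones for 8, a product of
  three factors 2: the outer factor in \<open>card_square_congruence\<close>, the one at its
  \<open>R^2\<close>, and the two signs of \<open>v\<close>. One \<open>\<tau>\<close> counts the
  classes of solutions there, the other comes from averaging \<open>gcd u q\<close>.\<close>

lemma sum_inverse_minlen_coprime:
  fixes q R :: int
  assumes q: "q > 0" and R: "R > 0"
  defines "P \<equiv> {(a, b). 0 < a \<and> a \<le> R \<and> 0 < b \<and> b \<le> R \<and> coprime a b \<and> coprime a q \<and> coprime b q}"
    and "\<tau> \<equiv> real (card {d. d dvd q \<and> d > 0})"
  shows "(\<Sum>(a,b)\<in>P. 1 / real (minlen q (a^2) (b^2))) \<le> 9 * \<tau>^2 * (1 + ln q) * (R + R^2 / sqrt q)"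
proof -
  have finP: "finite P" by (rule finite_subset[of _ "{0..R} \<times> {0..R}"]) (auto simp: P_def)
  have "P \<subseteq> {0<..R} \<times> {0<..R}" by (auto simp: P_def)
  then have "card P \<le> card ({0<..R} \<times> {0<..R})" by (intro card_mono) auto
  also have "\<dots> = nat R * nat R" by (simp add: card_cartesian_product)
  finally have "real (card P) \<le> real (nat R * nat R)" by (simp only: of_nat_le_iff)
  then have cardP: "real (card P) \<le> R^2" using R by (simp add: power2_eq_square)
  have finD: "finite {d. d dvd q \<and> d > 0}"
    using q by (auto intro: finite_subset[OF _ finite_divisors_int[of q]])
  have "card {1::int} \<le> card {d. d dvd q \<and> d > 0}" using finD by (intro card_mono) auto
  then have \<tau>1: "\<tau> \<ge> 1" by (simp add: \<tau>_def)
  have ln0: "ln q \<ge> 0" using q by simp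
  define T where "T = min (real_of_int R) (sqrt q)"
  have T1: "T \<ge> 1" using q R by (simp add: T_def)
  define N where "N = nat \<lfloor>T\<rfloor>"
  have N1: "N \<ge> 1" using T1 by (simp add: N_def le_nat_iff)
  have NT: "real N \<le> T" "T < real N + 1" using T1 unfolding N_def by linarith+
  let ?m = "\<lambda>p. minlen q ((fst p)^2) ((snd p)^2)"
  define P1 where "P1 = {p \<in> P. ?m p > N}"
  define P2 where "P2 = {p \<in> P. ?m p \<le> N}"
  define B where "B = R + R^2 / sqrt q"
  have sq: "sqrt q > 0" using q by simp
  have B0: "B \<ge> 0" using R sq by (simp add: B_def)
  have "(\<Sum>p\<in>P1. 1 / real (?m p)) \<le> (\<Sum>p\<in>P1. 1 / T)"
  proof (rule sum_mono)
    fix p assume "p \<in> P1"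
    then have "real N + 1 \<le> real (?m p)" by (simp add: P1_def)
    with NT T1 show "1 / real (?m p) \<le> 1 / T" by (intro divide_left_mono) auto
  qed
  also have "\<dots> = card P1 / T" by simp
  also have "\<dots> \<le> R^2 / T"
  proof (rule divide_right_mono)
    have "card P1 \<le> card P" using finP by (intro card_mono) (auto simp: P1_def)
    then show "real (card P1) \<le> R^2" using cardP by linarith
  qed (use T1 in auto)
  also have "\<dots> \<le> B"
  proof (cases "real_of_int R \<le> sqrt q")
    case True
    then have "R^2 / T = R" using R by (simp add: T_def min_def power2_eq_square)
    then show ?thesis using sq by (simp add: B_def)
  next
    case False
    then have "R^2 / T = R^2 / sqrt q" by (simp add: T_def min_def)
    then show ?thesis using R by (simp add: B_def)
  qed
  finally have S1: "(\<Sum>p\<in>P1. 1 / real (?m p)) \<le> B" .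

  have S2: "(\<Sum>p\<in>P2. 1 / real (?m p)) \<le> 8 * \<tau>^2 * (1 + ln q) * B"
  \<comment> \<open>The main argument needs \<open>N < q\<close>, so that a coordinate divisible by
    \<open>q\<close> vanishes. This fails for \<open>q = 1\<close>, where \<open>N = 1\<close>; but
    then \<open>B\<close> contains the full term \<open>R^2\<close> and the trivial bound
    suffices.\<close>
  proof (cases "q = 1")
    case True
    have "(\<Sum>p\<in>P2. 1 / real (?m p)) \<le> (\<Sum>p\<in>P2. 1)"
    proof (rule sum_mono)
      fix p show "1 / real (?m p) \<le> 1"
        using minlen_pos[OF q, of "(fst p)^2" "(snd p)^2"] by (simp add: divide_le_eq)
    qed
    also have "\<dots> = card P2" by simp
    also have "card P2 \<le> card P" using finP by (intro card_mono) (auto simp: P2_def)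
    also have "real (card P) \<le> R^2" by (rule cardP)
    also have "\<dots> \<le> 1 * B" using True R by (simp add: B_def)
    also have "\<dots> \<le> (8 * \<tau>^2 * (1 + ln q)) * B"
    proof (rule mult_right_mono)
      have "1 \<le> \<tau>^2 * (1 + ln q)" using mult_mono[of 1 "\<tau>^2" 1 "1 + ln q"] \<tau>1 ln0 by simp
      then show "1 \<le> 8 * \<tau>^2 * (1 + ln q)" by linarith
    qed (rule B0)
    finally show ?thesis by simp
  next
    case False
    then have q2: "q \<ge> 2" using q by simp
    have Nq: "int N < q"
    proof -
      have "1 < sqrt q" using q2 by simp
      then have "sqrt q * 1 < sqrt q * sqrt q" by (intro mult_strict_left_mono) auto
      then have "sqrt q < q" using q by simp
      then have "real N < q" using NT by (simp add: T_def)
      then show ?thesis by linarith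
    qed
    define V where "V = {- int N..int N} - {0}"
    define Z where "Z u v = {p \<in> P. q dvd u * (fst p)^2 - v * (snd p)^2}" for u v
    have finZ: "finite (Z u v)" for u v using finP by (simp add: Z_def)
    have ex: "\<exists>u\<in>{0<..int N}. \<exists>v\<in>V. p \<in> Z u v \<and> \<bar>v\<bar> \<le> int (?m p)" if p: "p \<in> P2" for p
    proof -
      obtain a b where ab: "p = (a, b)" by (cases p)
      have co: "coprime (a^2) q" "coprime (b^2) q" using p by (auto simp: P2_def P_def ab)
      obtain u v where uv: "(u, v) \<noteq> (0, 0)" "max \<bar>u\<bar> \<bar>v\<bar> = int (?m p)" "q dvd u * a^2 - v * b^2"
        using minlen_attained[OF q, of "a^2" "b^2"] by (auto simp: ab)
      have le: "\<bar>u\<bar> \<le> int N" "\<bar>v\<bar> \<le> int N" "\<bar>v\<bar> \<le> int (?m p)" using uv(2) p by (auto simp: P2_def)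
      have small: "x = 0" if "q dvd x" "\<bar>x\<bar> \<le> int N" for x
        using that Nq zdvd_imp_le[of q "\<bar>x\<bar>"] by fastforce
      have u0: "u \<noteq> 0"
      proof
        assume "u = 0"
        then have "q dvd v * b^2" using uv(3) by simp
        then have "q dvd v" using co by (metis coprime_commute coprime_dvd_mult_left_iff)
        with small le \<open>u = 0\<close> uv(1) show False by simp
      qed
      have v0: "v \<noteq> 0"
      proof
        assume "v = 0"
        then have "q dvd u * a^2" using uv(3) by simp
        then have "q dvd u" using co by (metis coprime_commute coprime_dvd_mult_left_iff)
        with small le u0 show False by simp
      qed
      show ?thesis
      proof (cases "u > 0")
        case True
        then show ?thesis using le u0 v0 uv(3) p
          by (intro bexI[of _ u] bexI[of _ v]) (auto simp: V_def Z_def P2_def ab)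
      next
        case False
        have "q dvd (- u) * a^2 - (- v) * b^2"
          using uv(3) dvd_minus_iff[of q "u * a^2 - v * b^2"] by simp
        then show ?thesis using le u0 v0 p False
          by (intro bexI[of _ "-u"] bexI[of _ "-v"]) (auto simp: V_def Z_def P2_def ab)
      qed
    qed
    \<comment> \<open>Weighting by v alone, instead of by the maximum of u and v, makes the sum over the
      vectors (u, v) factor.\<close>
    define W where "W = {0<..int N} \<times> V"
    have finW: "finite W" by (simp add: W_def V_def)
    have "(\<Sum>p\<in>P2. 1 / real (?m p)) \<le> (\<Sum>p\<in>P2. \<Sum>w\<in>W. if p \<in> Z (fst w) (snd w) then 1 / \<bar>real_of_int (snd w)\<bar> else 0)"
    proof (rule sum_mono)
      fix p assume "p \<in> P2"
      then obtain u v where uv: "u \<in> {0<..int N}" "v \<in> V" "p \<in> Z u v" "\<bar>v\<bar> \<le> int (?m p)"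
        using ex by blast
      have "real_of_int \<bar>v\<bar> \<le> real (?m p)" using uv(4) by linarith
      then have "1 / real (?m p) \<le> 1 / \<bar>real_of_int v\<bar>"
        using uv(2) by (intro divide_left_mono) (auto simp: V_def)
      also have "\<dots> = (\<Sum>w\<in>{(u, v)}. if p \<in> Z (fst w) (snd w) then 1 / \<bar>real_of_int (snd w)\<bar> else 0)"
        using uv by simp
      also have "\<dots> \<le> (\<Sum>w\<in>W. if p \<in> Z (fst w) (snd w) then 1 / \<bar>real_of_int (snd w)\<bar> else 0)"
        using uv finW by (intro sum_mono2) (auto simp: W_def)
      finally show "1 / real (?m p) \<le> \<dots>" .
    qed
    also have "\<dots> = (\<Sum>w\<in>W. \<Sum>p\<in>P2. if p \<in> Z (fst w) (snd w) then 1 / \<bar>real_of_int (snd w)\<bar> else 0)"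
      by (rule sum.swap)
    also have "\<dots> \<le> (\<Sum>w\<in>W. \<Sum>p\<in>P. if p \<in> Z (fst w) (snd w) then 1 / \<bar>real_of_int (snd w)\<bar> else 0)"
      using finP by (intro sum_mono sum_mono2) (auto simp: P2_def)
    also have "\<dots> = (\<Sum>w\<in>W. card (Z (fst w) (snd w)) * (1 / \<bar>real_of_int (snd w)\<bar>))"
    proof (rule sum.cong)
      fix w
      have "P \<inter> {p. p \<in> Z (fst w) (snd w)} = Z (fst w) (snd w)" by (auto simp: Z_def)
      then show "(\<Sum>p\<in>P. if p \<in> Z (fst w) (snd w) then 1 / \<bar>real_of_int (snd w)\<bar> else 0) =
          card (Z (fst w) (snd w)) * (1 / \<bar>real_of_int (snd w)\<bar>)"
        using finP by (simp add: sum.If_cases)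
    qed simp
    also have "\<dots> \<le> (\<Sum>w\<in>W. (\<tau> * (2 * (1 + 2 * R^2 * gcd (fst w) q / q))) * (1 / \<bar>real_of_int (snd w)\<bar>))"
    proof (intro sum_mono mult_right_mono)
      fix w assume "w \<in> W"
      then have u: "fst w > 0" by (auto simp: W_def)
      have "Z (fst w) (snd w) = {(a, b). 0 < a \<and> a \<le> R \<and> 0 < b \<and> b \<le> R \<and> coprime a b \<and> coprime a q \<and>
            coprime b q \<and> q dvd fst w * a^2 - snd w * b^2}"
        by (auto simp: Z_def P_def)
      then show "real (card (Z (fst w) (snd w))) \<le> \<tau> * (2 * (1 + 2 * R^2 * gcd (fst w) q / q))"
        using card_square_congruence[OF q u R, of "snd w"] by (simp add: \<tau>_def)
    qed simp
    also have "\<dots> = (\<Sum>u\<in>{0<..int N}. \<tau> * (2 * (1 + 2 * R^2 * gcd u q / q))) * (\<Sum>v\<in>V. 1 / \<bar>real_of_int v\<bar>)"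
      unfolding W_def sum_product sum.cartesian_product by (simp add: case_prod_beta)
    also have "(\<Sum>u\<in>{0<..int N}. \<tau> * (2 * (1 + 2 * R^2 * gcd u q / q))) =
        2 * \<tau> * (N + 2 * R^2 / q * (\<Sum>u\<in>{0<..int N}. real_of_int (gcd u q)))"
      by (simp add: sum_distrib_left sum_divide_distrib sum.distrib algebra_simps)
    also have "(\<Sum>v\<in>V. 1 / \<bar>real_of_int v\<bar>) = 2 * harm N"
    proof -
      have "V = {0<..int N} \<union> uminus ` {0<..int N}"
      proof (intro equalityI subsetI)
        fix v assume "v \<in> V"
        then show "v \<in> {0<..int N} \<union> uminus ` {0<..int N}"
          by (cases "v > 0") (auto simp: V_def image_iff intro: bexI[of _ "- v"])
      qed (auto simp: V_def)
      then have "(\<Sum>v\<in>V. 1 / \<bar>real_of_int v\<bar>) = (\<Sum>v\<in>{0<..int N}. 1 / \<bar>real_of_int v\<bar>) + (\<Sum>v\<in>uminus ` {0<..int N}. 1 / \<bar>real_of_int v\<bar>)"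
        by (simp only:) (rule sum.union_disjoint, auto)
      also have "(\<Sum>v\<in>uminus ` {0<..int N}. 1 / \<bar>real_of_int v\<bar>) = (\<Sum>v\<in>{0<..int N}. 1 / \<bar>real_of_int v\<bar>)"
        by (subst sum.reindex) (auto simp: inj_on_def)
      also have "(\<Sum>v\<in>{0<..int N}. 1 / \<bar>real_of_int v\<bar>) = (\<Sum>v\<in>{1..N}. 1 / real v)"
        by (rule sum.reindex_bij_witness[of _ int nat]) auto
      finally show ?thesis by (simp add: harm_def inverse_eq_divide)
    qed
    \<comment> \<open>Both halves of the minimum \<open>T\<close> enter: \<open>N \<le> R\<close>
      bounds the first summand, and \<open>N \<le> sqrt q\<close> turns \<open>R^2 / q * N\<close>
      into \<open>R^2 / sqrt q\<close>.\<close>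
    also have "2 * \<tau> * (N + 2 * R^2 / q * (\<Sum>u\<in>{0<..int N}. real_of_int (gcd u q))) * (2 * harm N) \<le>
        2 * \<tau> * (\<tau> * (2 * B)) * (2 * (1 + ln q))"
    proof (intro mult_mono mult_left_mono)
      have "(\<Sum>u\<in>{0<..int N}. real_of_int (gcd u q)) \<le> N * \<tau>"
        using sum_gcd_le[OF q, of N] by (simp add: \<tau>_def)
      then have "2 * R^2 / q * (\<Sum>u\<in>{0<..int N}. real_of_int (gcd u q)) \<le> 2 * R^2 / q * (sqrt q * \<tau>)"
      proof (intro mult_left_mono)
        have "N * \<tau> \<le> sqrt q * \<tau>" using NT \<tau>1 by (intro mult_right_mono) (auto simp: T_def)
        then show "(\<Sum>u\<in>{0<..int N}. real_of_int (gcd u q)) \<le> sqrt q * \<tau>"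
          using \<open>_ \<le> N * \<tau>\<close> by linarith
      qed (use q in auto)
      also have "\<dots> = \<tau> * (2 * (R^2 / sqrt q))"
        using q by (simp add: field_simps real_div_sqrt)
      finally have 1: "2 * R^2 / q * (\<Sum>u\<in>{0<..int N}. real_of_int (gcd u q)) \<le> \<tau> * (2 * (R^2 / sqrt q))" .
      have "real N \<le> R" using NT by (simp add: T_def)
      also have "\<dots> \<le> \<tau> * (2 * R)" using \<tau>1 R mult_mono[of 1 \<tau> R "2 * R"] by simp
      finally show "N + 2 * R^2 / q * (\<Sum>u\<in>{0<..int N}. real_of_int (gcd u q)) \<le> \<tau> * (2 * B)"
        using 1 by (simp add: B_def algebra_simps)
      have "harm N \<le> 1 + ln (real N)" using N1 by (intro harm_le_ln) auto
      also have "ln (real N) \<le> ln q" using Nq N1 by (intro ln_mono) auto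
      finally show "harm N \<le> 1 + ln q" by simp
    qed (use \<tau>1 B0 q in \<open>auto simp: harm_nonneg intro!: add_nonneg_nonneg divide_nonneg_nonneg mult_nonneg_nonneg sum_nonneg\<close>)
    also have "\<dots> = 8 * \<tau>^2 * (1 + ln q) * B" by (simp add: power2_eq_square)
    finally show ?thesis .
  qed
  have "B \<le> \<tau>^2 * (1 + ln q) * B"
  proof -
    have "1 \<le> \<tau>^2 * (1 + ln q)" using mult_mono[of 1 "\<tau>^2" 1 "1 + ln q"] \<tau>1 ln0 by simp
    then show ?thesis using B0 mult_right_mono[of 1 _ B] by simp
  qed
  moreover have "(\<Sum>p\<in>P. 1 / real (?m p)) = (\<Sum>p\<in>P1. 1 / real (?m p)) + (\<Sum>p\<in>P2. 1 / real (?m p))"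
  proof -
    have "P = P1 \<union> P2" by (auto simp: P1_def P2_def)
    then show ?thesis using finP by (simp only:) (rule sum.union_disjoint, auto simp: P1_def P2_def)
  qed
  ultimately have "(\<Sum>p\<in>P. 1 / real (?m p)) \<le> 9 * \<tau>^2 * (1 + ln q) * B"
    using S1 S2 by linarith
  then show ?thesis by (simp add: B_def case_prod_beta)
qed

lemma minlen_scale:
  fixes q A B g :: int
  assumes "coprime g q"
  shows "minlen q (g * A) (g * B) = minlen q A B"
proof -
  have "q dvd u * (g * A) - v * (g * B) \<longleftrightarrow> q dvd u * A - v * B" for u v
  proof -
    have "u * (g * A) - v * (g * B) = (u * A - v * B) * g" by (simp add: algebra_simps)
    then show ?thesis using assms by (simp add: coprime_commute coprime_dvd_mult_left_iff)
  qed
  then show ?thesis by (simp add: minlen_def)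
qed

text \<open>Pairs are sorted by their gcd \<open>g\<close>. As a divisor of \<open>a\<close>,
  \<open>g\<close> is coprime to \<open>q\<close>, so by \<open>minlen_scale\<close> dividing both
  entries by \<open>g\<close> leaves the minimal length unchanged and leads to coprime pairs up to
  \<open>B div g\<close>. The sum of \<open>1 / g\<close> produces \<open>1 + ln B\<close>.\<close>

lemma sum_inverse_minlen:
  fixes q B :: int
  assumes q: "q > 0" and B: "B > 0"
  defines "U \<equiv> {a. 0 < a \<and> a \<le> B \<and> coprime a q}"
    and "\<tau> \<equiv> real (card {d. d dvd q \<and> d > 0})"
  shows "(\<Sum>(a,b)\<in>U \<times> U. 1 / real (minlen q (a^2) (b^2))) \<le>
           9 * \<tau>^2 * (1 + ln q) * (1 + ln B) * (B + B^2 / sqrt q)"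
proof -
  have finU: "finite (U \<times> U)" by (rule finite_subset[of _ "{0..B} \<times> {0..B}"]) (auto simp: U_def)
  define f where "f p = 1 / real (minlen q ((fst p)^2) ((snd p)^2))" for p :: "int \<times> int"
  define gc where "gc p = nat (gcd (fst p) (snd p))" for p :: "int \<times> int"
  define P where "P R = {(a, b). 0 < a \<and> a \<le> R \<and> 0 < b \<and> b \<le> R \<and> coprime a b \<and> coprime a q \<and> coprime b q}" for R
  define M where "M = 9 * \<tau>^2 * (1 + ln q)"
  have M: "M \<ge> 0" using q by (simp add: M_def \<tau>_def)
  define n where "n = nat B"
  have n: "n > 0" "int n = B" using B by (auto simp: n_def)
  have sq: "sqrt q > 0" using q by simp
  have cls: "sum f {p \<in> U \<times> U. gc p = g} \<le> M * (B + B^2 / sqrt q) * (1 / real g)" if g: "g \<in> {1..n}" for g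
  proof (cases "coprime (int g) q")
    case False
    have "{p \<in> U \<times> U. gc p = g} = {}"
    proof (rule ccontr)
      assume "\<not> ?thesis"
      then obtain p where p: "p \<in> U \<times> U" "gc p = g" by blast
      then have "int g dvd fst p" "coprime (fst p) q" by (auto simp: gc_def U_def)
      with False show False by (metis coprime_divisors dvd_refl)
    qed
    then have "sum f {p \<in> U \<times> U. gc p = g} = 0" by (simp only: sum.empty)
    then show ?thesis using M B sq by simp
  next
    case True
    define R where "R = B div int g"
    have g0: "int g > 0" using g by simp
    have R: "R > 0" using g n by (simp add: R_def pos_imp_zdiv_pos_iff)
    define h where "h = (\<lambda>p :: int \<times> int. (fst p div int g, snd p div int g))"
    let ?S = "{p \<in> U \<times> U. gc p = g}"
    have S: "fst p = int g * fst (h p)" "snd p = int g * snd (h p)" "h p \<in> P R" if "p \<in> ?S" for p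
    proof -
      have gg: "gcd (fst p) (snd p) = int g" using that g0 by (auto simp: gc_def)
      then have d: "int g dvd fst p" "int g dvd snd p" by (metis gcd_dvd1, metis gcd_dvd2)
      then show e: "fst p = int g * fst (h p)" "snd p = int g * snd (h p)" by (simp_all add: h_def)
      have U: "fst p \<in> U" "snd p \<in> U" using that by auto
      have "coprime (fst (h p)) (snd (h p))"
        unfolding h_def fst_conv snd_conv gg[symmetric] using U by (intro div_gcd_coprime) (auto simp: U_def)
      moreover have "coprime (fst (h p)) q" "coprime (snd (h p)) q"
        using U e by (auto simp: U_def)
      moreover have "0 < fst (h p)" "0 < snd (h p)"
        using U e g0 by (auto simp: U_def zero_less_mult_iff)
      moreover have "fst (h p) \<le> R" "snd (h p) \<le> R"
        unfolding h_def R_def fst_conv snd_conv using U g0 by (auto simp: U_def intro!: zdiv_mono1)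
      ultimately show "h p \<in> P R" by (cases "h p") (simp add: P_def)
    qed
    have "sum f ?S = (\<Sum>p\<in>?S. f (h p))"
    proof (rule sum.cong)
      fix p assume p: "p \<in> ?S"
      have "(fst p)^2 = (int g)^2 * (fst (h p))^2" "(snd p)^2 = (int g)^2 * (snd (h p))^2"
        using S(1)[OF p] S(2)[OF p] by (metis power_mult_distrib)+
      then show "f p = f (h p)" using True by (simp add: f_def minlen_scale)
    qed simp
    also have "\<dots> = sum f (h ` ?S)"
    proof (rule sum.reindex_cong[symmetric, of h])
      show "inj_on h ?S"
      proof (rule inj_onI)
        fix x y assume "x \<in> ?S" "y \<in> ?S" "h x = h y"
        then show "x = y" using S(1,2)[of x] S(1,2)[of y] by (simp add: prod_eq_iff)
      qed
    qed auto
    also have "\<dots> \<le> sum f (P R)"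
    proof (rule sum_mono2)
      show "finite (P R)" by (rule finite_subset[of _ "{0..R} \<times> {0..R}"]) (auto simp: P_def)
      show "h ` ?S \<subseteq> P R" using S(3) by blast
    qed (simp add: f_def)
    also have "\<dots> \<le> M * (real_of_int R + (real_of_int R)^2 / sqrt q)"
      using sum_inverse_minlen_coprime[OF q R] by (simp add: f_def P_def M_def \<tau>_def case_prod_beta)
    also have "\<dots> \<le> M * (real_of_int B / real g + ((real_of_int B)^2 / real g) / sqrt q)"
    proof (intro mult_left_mono add_mono divide_right_mono)
      have "real_of_int R \<le> real_of_int B / real_of_int (int g)" unfolding R_def by (rule real_of_int_div4)
      then show Rle: "real_of_int R \<le> real_of_int B / real g" by simp
      have "(real_of_int R)^2 \<le> (real_of_int B / real g)^2" using R by (intro power_mono Rle) auto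
      \<comment> \<open>The square term would allow \<open>1 / g^2\<close>; weakening it to
        \<open>1 / g\<close> gives both terms the same dependence on \<open>g\<close>.\<close>
      also have "real g \<le> real g ^ 2" using g by (simp add: power2_eq_square)
      then have "(real_of_int B / real g)^2 \<le> (real_of_int B)^2 / real g"
        unfolding power_divide using g by (intro divide_left_mono) auto
      finally show "(real_of_int R)^2 \<le> (real_of_int B)^2 / real g" .
    qed (use M sq in auto)
    also have "\<dots> = M * (B + B^2 / sqrt q) * (1 / real g)"
      by (simp add: distrib_left distrib_right add_divide_distrib mult_ac)
    finally show ?thesis .
  qed
  have "gc ` (U \<times> U) \<subseteq> {1..n}"
  proof clarify
    fix a b assume "a \<in> U" "b \<in> U"
    moreover obtain G where G: "G = gcd a b" by blast
    ultimately have "G > 0" "G \<le> a" "a \<le> B" by (auto simp: U_def intro: gcd_le1_int)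
    then have "nat G \<in> {1..n}" by (auto simp: n_def)
    then show "gc (a, b) \<in> {1..n}" by (simp add: gc_def G)
  qed
  then have "sum f (U \<times> U) = (\<Sum>g\<in>{1..n}. sum f {p \<in> U \<times> U. gc p = g})"
    using finU by (intro sum.group[symmetric]) auto
  also have "\<dots> \<le> (\<Sum>g\<in>{1..n}. M * (B + B^2 / sqrt q) * (1 / real g))"
    by (intro sum_mono cls)
  also have "\<dots> = M * (B + B^2 / sqrt q) * harm n"
    by (simp add: sum_distrib_left harm_def inverse_eq_divide)
  also have "\<dots> \<le> M * (B + B^2 / sqrt q) * (1 + ln B)"
  proof (intro mult_left_mono)
    have "real n = real_of_int B" using n by (metis of_int_of_nat_eq)
    then show "harm n \<le> 1 + ln B" using harm_le_ln[OF n(1)] by simp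
  qed (use M B sq in auto)
  finally show ?thesis by (simp add: f_def M_def case_prod_beta mult_ac)
qed

section \<open>Squarefree integers and the divisor function\<close>

lemma prime_factors_prod_primes:
  fixes X :: "nat set"
  assumes X: "finite X" "\<And>p. p \<in> X \<Longrightarrow> prime p"
  shows "prime_factors (\<Prod>X) = X"
proof -
  have "prime_factors (\<Prod>X) = \<Union> ((prime_factors \<circ> (\<lambda>x. x)) ` X)"
    using X by (intro prime_factors_prod) (auto dest: prime_gt_0_nat)
  also have "\<dots> = X" using X by (auto simp: prime_prime_factors prime_factorization_prime)
  finally show ?thesis .
qed

lemma squarefree_prod_primes:
  fixes X :: "nat set"
  assumes "finite X" "\<And>p. p \<in> X \<Longrightarrow> prime p"
  shows "squarefree (\<Prod>X)"
  using assms by (intro squarefree_prod_coprime) (auto simp: primes_coprime squarefree_prime)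

lemma bij_betw_prod_squarefree:
  fixes A :: "nat set"
  assumes A: "finite A" "\<And>p. p \<in> A \<Longrightarrow> prime p"
  shows "bij_betw (\<lambda>X. \<Prod>X) (Pow A) {d. squarefree d \<and> prime_factors d \<subseteq> A}"
proof (rule bij_betw_byWitness[where f' = prime_factors])
  have pf: "prime_factors (\<Prod>X) = X" and sf: "squarefree (\<Prod>X)" if "X \<subseteq> A" for X
  proof -
    have "finite X" "\<And>p. p \<in> X \<Longrightarrow> prime p" using that A finite_subset by auto
    then show "prime_factors (\<Prod>X) = X" "squarefree (\<Prod>X)"
      by (simp_all add: prime_factors_prod_primes squarefree_prod_primes)
  qed
  show "\<forall>X\<in>Pow A. prime_factors (\<Prod>X) = X" using pf by blast
  show "(\<lambda>X. \<Prod>X) ` Pow A \<subseteq> {d. squarefree d \<and> prime_factors d \<subseteq> A}"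
    using pf sf by auto
  show "\<forall>d\<in>{d. squarefree d \<and> prime_factors d \<subseteq> A}. \<Prod>(prime_factors d) = d"
  proof clarify
    fix d :: nat assume d: "squarefree d" "prime_factors d \<subseteq> A"
    then have "d \<noteq> 0" by (cases "d = 0") auto
    then have "d = (\<Prod>p\<in>prime_factors d. p ^ multiplicity p d)" by (simp add: prod_prime_factors)
    also have "\<dots> = (\<Prod>p\<in>prime_factors d. p)"
      using d \<open>d \<noteq> 0\<close> by (intro prod.cong) (auto simp: squarefree_factorial_semiring')
    finally show "\<Prod>(prime_factors d) = d" by simp
  qed
  show "prime_factors ` {d. squarefree d \<and> prime_factors d \<subseteq> A} \<subseteq> Pow A" by blast
qed

lemma finite_squarefree_prime_factors:
  fixes A :: "nat set"
  assumes "finite A" "\<And>p. p \<in> A \<Longrightarrow> prime p"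
  shows "finite {d. squarefree d \<and> prime_factors d \<subseteq> A}"
  using bij_betw_finite[OF bij_betw_prod_squarefree[OF assms]] assms by simp

text \<open>A finite Euler product: expanding the product over \<open>A\<close> gives one term for
  each subset, that is, for each squarefree integer with prime factors in \<open>A\<close>. It is
  used with \<open>f = 1\<close> for divisor sums and with \<open>1 / d^2\<close> for the
  density.\<close>

lemma sum_moebius_squarefree:
  fixes A :: "nat set" and f :: "nat \<Rightarrow> real"
  assumes A: "finite A" "\<And>p. p \<in> A \<Longrightarrow> prime p"
    and f: "f 1 = 1" "\<And>m n. f (m * n) = f m * f n"
  shows "(\<Sum>d | squarefree d \<and> prime_factors d \<subseteq> A. moebius d * f d) = (\<Prod>p\<in>A. 1 - f p)"
proof -
  have f_prod: "f (\<Prod>X) = (\<Prod>p\<in>X. f p)" for X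
    by (induction X rule: infinite_finite_induct) (auto simp: f[simplified])
  have pf: "prime_factors (\<Prod>X) = X" and sf: "squarefree (\<Prod>X)" if "X \<subseteq> A" for X
  proof -
    have "finite X" "\<And>p. p \<in> X \<Longrightarrow> prime p" using that A finite_subset by auto
    then show "prime_factors (\<Prod>X) = X" "squarefree (\<Prod>X)"
      by (simp_all add: prime_factors_prod_primes squarefree_prod_primes)
  qed
  have "(\<Sum>d | squarefree d \<and> prime_factors d \<subseteq> A. moebius d * f d) = (\<Sum>X\<in>Pow A. moebius (\<Prod>X) * f (\<Prod>X))"
    by (rule sum.reindex_bij_betw[OF bij_betw_prod_squarefree[OF A], symmetric]) 
  also have "\<dots> = (\<Sum>X\<in>Pow A. (-1) ^ card X * (\<Prod>p\<in>X. f p) * (\<Prod>p\<in>A-X. 1))"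
    by (intro sum.cong) (auto simp: moebius_def pf sf f_prod)
  also have "\<dots> = (\<Prod>p\<in>A. 1 - f p)"
    using A by (intro prod_diff_conv_sum[symmetric])
  finally show ?thesis .
qed

text \<open>The Euler product with \<open>f = 1\<close> over the primes dividing \<open>n\<close>:
  it has a factor 0 unless there are no such primes.\<close>

lemma sum_moebius_divisors:
  fixes n :: nat
  assumes "n > 0"
  shows "(\<Sum>d | d dvd n. moebius d) = (if n = 1 then 1 else 0)"
proof -
  have A: "finite (prime_factors n)" "\<And>p. p \<in> prime_factors n \<Longrightarrow> prime p" by auto
  have sub: "squarefree d \<and> d dvd n \<longleftrightarrow> squarefree d \<and> prime_factors d \<subseteq> prime_factors n" for d
  proof safe
    assume d: "squarefree d" "prime_factors d \<subseteq> prime_factors n"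
    then have "d \<noteq> 0" by (cases "d = 0") auto
    show "d dvd n"
    proof (rule multiplicity_le_imp_dvd[OF \<open>d \<noteq> 0\<close>])
      fix p :: nat assume "prime p"
      show "multiplicity p d \<le> multiplicity p n"
      proof (cases "p \<in> prime_factors d")
        case True
        then have "multiplicity p d = 1" using d \<open>d \<noteq> 0\<close> by (auto simp: squarefree_factorial_semiring')
        moreover have "multiplicity p n > 0" using True d(2) by (auto simp: prime_factors_multiplicity)
        ultimately show ?thesis by simp
      qed (use \<open>prime p\<close> in \<open>auto simp: prime_factors_multiplicity\<close>)
    qed
  qed (use assms dvd_prime_factors[of n] in auto)
  have "real_of_int (\<Sum>d | d dvd n. moebius d) = (\<Sum>d | d dvd n. real_of_int (moebius d) * 1)" by simp
  also have "\<dots> = (\<Sum>d | squarefree d \<and> d dvd n. real_of_int (moebius d) * 1)"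
    using assms by (intro sum.mono_neutral_right) (auto simp: moebius_def)
  also have "\<dots> = (\<Sum>d | squarefree d \<and> prime_factors d \<subseteq> prime_factors n. real_of_int (moebius d) * 1)"
    by (simp only: sub)
  also have "\<dots> = (\<Prod>p\<in>prime_factors n. 1 - 1)"
    using sum_moebius_squarefree[OF A, of "\<lambda>_. 1"] by simp
  also have "\<dots> = (if n = 1 then 1 else 0)"
  proof (cases "n = 1")
    case False
    then obtain p where "prime p" "p dvd n" using prime_factor_nat by blast
    then have "p \<in> prime_factors n" using assms by (simp add: in_prime_factors_iff)
    then show ?thesis using False by (subst prod_zero) auto
  qed simp
  also have "\<dots> = real_of_int (if n = 1 then 1 else 0)" by simp
  finally show ?thesis by (simp only: of_int_eq_iff)
qed

text \<open>\<open>d^2 dvd n\<close> is equivalent to \<open>d dvd square_part n\<close>, which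
  reduces the sum to a full divisor sum; and \<open>square_part n = 1\<close> characterises
  squarefree \<open>n\<close>.\<close>

lemma abs_moebius_eq_sum:
  fixes n :: nat
  assumes "n > 0"
  shows "\<bar>moebius n\<bar> = (\<Sum>d | d^2 dvd n. moebius d)"
proof -
  have "(\<Sum>d | d^2 dvd n. moebius d) = (\<Sum>d | d dvd square_part n. moebius d)"
    by (simp add: dvd_square_part_iff)
  also have "\<dots> = (if square_part n = 1 then 1 else 0)"
  proof (rule sum_moebius_divisors)
    have "square_part n \<noteq> 0" using assms by simp
    then show "square_part n > 0" by (rule neq0_conv[THEN iffD1])
  qed
  also have "square_part n = 1 \<longleftrightarrow> squarefree n"
  proof
    assume "square_part n = 1"
    then show "squarefree n" by (intro squarefreeI) (simp flip: dvd_square_part_iff)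
  next
    assume "squarefree n"
    then show "square_part n = 1" using squarefreeD[OF _ square_part_square_dvd, of n] by simp
  qed
  finally show ?thesis by (simp add: abs_moebius)
qed

lemma abs_moebius_le_1: "\<bar>real_of_int (moebius n)\<bar> \<le> 1"
  by (simp only: of_int_abs[symmetric] abs_moebius) simp

lemma sum_inverse_squares_le:
  assumes "m > 0"
  shows "(\<Sum>d=Suc m..n. 1 / real d ^ 2) \<le> 1 / m"
proof -
  \<comment> \<open>The term \<open>- 1 / n\<close> is added so that the induction
    telescopes.\<close>
  have "(\<Sum>d=Suc m..n. 1 / real d ^ 2) \<le> 1 / m - 1 / n" if "n \<ge> m" for n
    using that
  proof (induction n rule: dec_induct)
    case (step n)
    have n: "n > 0" using step assms by simp
    have "1 / real (Suc n) ^ 2 \<le> 1 / (real n * (Suc n))"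
      using n by (intro divide_left_mono) (auto simp: power2_eq_square)
    also have "\<dots> = 1 / n - 1 / Suc n" using n by (simp add: field_simps)
    finally show ?case using step by simp
  qed simp
  from this[of n] show ?thesis using assms
    by (cases "n \<ge> m") (auto intro: order_trans)
qed

text \<open>For \<open>n \<ge> m\<close> the partial product over \<open>p \<le> n\<close> is a
  Moebius sum over squarefree integers coprime to \<open>q\<close> that include all those up to
  \<open>m\<close>. The others exceed \<open>m\<close>, so the difference is at most the tail of the
  sum of \<open>1 / d^2\<close>. That bound does not depend on \<open>n\<close> and survives the
  limit.\<close>

lemma sqfree_density_approx:
  fixes q m :: nat
  assumes q: "q > 0" and m: "m > 0"
  shows "\<bar>sqfree_density q - (\<Sum>d | d \<in> {1..m} \<and> coprime d q. moebius d / real d ^ 2)\<bar> \<le> 1 / m"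
proof -
  let ?g = "\<lambda>d. real_of_int (moebius d) / real d ^ 2"
  let ?s = "(\<Sum>d | d \<in> {1..m} \<and> coprime d q. ?g d)"
  define f where "f p = (if prime p \<and> \<not> p dvd q then 1 - 1 / real p ^ 2 else 1)" for p
  have "\<bar>(\<Prod>p\<le>n. f p) - ?s\<bar> \<le> 1 / m" if n: "n \<ge> m" for n
  proof -
    define A where "A = {p. p \<le> n \<and> prime p \<and> \<not> p dvd q}"
    define D where "D = {d. squarefree d \<and> prime_factors d \<subseteq> A}"
    have A: "finite A" "\<And>p. p \<in> A \<Longrightarrow> prime p" by (auto simp: A_def)
    have finD: "finite D" unfolding D_def by (rule finite_squarefree_prime_factors[OF A])
    have "(\<Prod>p\<le>n. f p) = (\<Prod>p\<in>A. f p)"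
      by (intro prod.mono_neutral_right) (auto simp: A_def f_def)
    also have "\<dots> = (\<Prod>p\<in>A. 1 - 1 / real p ^ 2)"
      by (intro prod.cong) (auto simp: A_def f_def)
    also have "\<dots> = (\<Sum>d\<in>D. moebius d * (1 / real d ^ 2))"
      unfolding D_def by (rule sum_moebius_squarefree[OF A, symmetric]) (auto simp: power_mult_distrib)
    finally have 1: "(\<Prod>p\<le>n. f p) = (\<Sum>d\<in>D. ?g d)"
      by (simp only: times_divide_eq_right mult_1_right)
    have copr: "coprime d q" if "d \<in> D" for d
    proof (rule ccontr)
      assume "\<not> coprime d q"
      then have "gcd d q \<noteq> 1" using coprime_iff_gcd_eq_1 by blast
      then obtain p where "prime p" "p dvd gcd d q" using prime_factor_nat by blast
      then have p: "prime p" "p dvd d" "p dvd q" by auto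
      with that have "p \<in> prime_factors d" by (cases "d = 0") (auto simp: D_def in_prime_factors_iff)
      with that have "p \<in> A" by (auto simp: D_def)
      with \<open>p dvd q\<close> show False by (simp add: A_def)
    qed
    have inD: "d \<in> D" if "d \<in> {1..m}" "coprime d q" "squarefree d" for d
    proof -
      have "p \<in> A" if p: "p \<in> prime_factors d" for p
      proof -
        have "prime p" "p dvd d" using p by (auto simp: in_prime_factors_iff)
        moreover have "p \<le> d" using \<open>p dvd d\<close> that(1) \<open>d \<in> {1..m}\<close> by (intro dvd_imp_le) auto
        moreover have "\<not> p dvd q"
          using \<open>coprime d q\<close> \<open>prime p\<close> \<open>p dvd d\<close> coprime_common_divisor[of d q p] not_prime_unit by blast
        ultimately show ?thesis using n \<open>d \<in> {1..m}\<close> by (auto simp: A_def)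
      qed
      with that show ?thesis by (auto simp: D_def)
    qed
    have "?s = (\<Sum>d \<in> D \<inter> {1..m}. ?g d)"
    proof (rule sum.mono_neutral_right)
      show "\<forall>d\<in>{d. d \<in> {1..m} \<and> coprime d q} - D \<inter> {1..m}. ?g d = 0"
        using inD by (auto simp: moebius_def)
    qed (use copr in auto)
    moreover have "(\<Sum>d\<in>D. ?g d) = (\<Sum>d \<in> D \<inter> {1..m}. ?g d) + (\<Sum>d \<in> D - {1..m}. ?g d)"
      by (rule sum.Int_Diff[OF finD])
    ultimately have "\<bar>(\<Prod>p\<le>n. f p) - ?s\<bar> = \<bar>\<Sum>d \<in> D - {1..m}. ?g d\<bar>" using 1 by simp
    also have "\<dots> \<le> (\<Sum>d \<in> D - {1..m}. 1 / real d ^ 2)"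
      by (rule order_trans[OF sum_abs]) (intro sum_mono, simp add: divide_right_mono abs_moebius_le_1)
    \<comment> \<open>\<open>D\<close> is finite, so a finite tail suffices.\<close>
    also have "\<dots> \<le> (\<Sum>d=Suc m..Max D. 1 / real d ^ 2)"
    proof (rule sum_mono2)
      show "D - {1..m} \<subseteq> {Suc m..Max D}"
      proof
        fix d assume d: "d \<in> D - {1..m}"
        then have "d \<noteq> 0" by (cases "d = 0") (auto simp: D_def)
        with d show "d \<in> {Suc m..Max D}" using finD by (auto simp: not_le)
      qed
    qed auto
    also have "\<dots> \<le> 1 / m" by (rule sum_inverse_squares_le[OF m])
    finally show ?thesis .
  qed
  then have ev: "\<forall>\<^sub>F n in sequentially. \<bar>(\<Prod>p\<le>n. f p) - ?s\<bar> \<le> 1 / m"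
    by (auto simp: eventually_sequentially)
  have "f = (\<lambda>p. if prime p \<and> \<not> p dvd q then 1 - 1 / real p ^ 2 else 1)"
    by (simp add: fun_eq_iff f_def)
  then have "f has_prod sqfree_density q" using sqfree_density_has_prod[of q] by simp
  then have "(\<lambda>n. \<Prod>p\<le>n. f p) \<longlonglongrightarrow> sqfree_density q" by (rule has_prod_imp_tendsto)
  then have "(\<lambda>n. \<bar>(\<Prod>p\<le>n. f p) - ?s\<bar>) \<longlonglongrightarrow> \<bar>sqfree_density q - ?s\<bar>"
    by (intro tendsto_intros)
  from tendsto_upperbound[OF this ev] show ?thesis by simp
qed

section \<open>The divisor bound\<close>

lemma card_divisors_prime_power_mult_le:
  fixes p m :: nat
  assumes p: "prime p" and m: "m > 0"
  shows "card {d. d dvd p ^ k * m} \<le> (k + 1) * card {d. d dvd m}"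
proof -
  have "{d. d dvd p ^ k * m} \<subseteq> (\<lambda>(i, d). p ^ i * d) ` ({..k} \<times> {d. d dvd m})"
  proof
    fix d assume "d \<in> {d. d dvd p ^ k * m}"
    then obtain a b where d: "d = a * b" "a dvd p ^ k" "b dvd m"
      using division_decomp[of d "p ^ k" m] by auto
    then obtain i where "i \<le> k" "a = p ^ i" using divides_primepow_nat[OF p] by blast
    with d show "d \<in> (\<lambda>(i, d). p ^ i * d) ` ({..k} \<times> {d. d dvd m})" by force
  qed
  then have "card {d. d dvd p ^ k * m} \<le> card ((\<lambda>(i, d). p ^ i * d) ` ({..k} \<times> {d. d dvd m}))"
    using m by (intro card_mono) auto
  also have "\<dots> \<le> card ({..k} \<times> {d. d dvd m})"
    using m by (intro card_image_le) auto
  finally show ?thesis by (simp add: card_cartesian_product)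
qed

text \<open>The exact power \<open>p^k\<close> in \<open>n\<close> contributes \<open>k + 1\<close>
  divisors. For \<open>p \<ge> N\<close> one has \<open>p powr \<epsilon> \<ge> 2\<close>, so
  \<open>k + 1 \<le> 2^k\<close> is absorbed by the power of \<open>p\<close>. For smaller
  \<open>p\<close>, \<open>exp t \<ge> 1 + t\<close> shows that a factor \<open>B\<close> is enough.
  Fewer than or exactly \<open>N\<close> primes are of the second kind, hence the constant
  \<open>B^N\<close>.\<close>

lemma card_divisors_le_powr:
  fixes \<epsilon> :: real
  assumes \<epsilon>: "\<epsilon> > 0"
  shows "\<exists>C\<ge>1. \<forall>n>0. real (card {d::nat. d dvd n}) \<le> C * real n powr \<epsilon>"
proof -
  define N :: nat where "N = nat \<lceil>2 powr (1 / \<epsilon>)\<rceil>"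
  define B where "B = max 1 (1 / (\<epsilon> * ln 2))"
  have B: "B \<ge> 1" "B * (\<epsilon> * ln 2) \<ge> 1" 
    using \<epsilon> by (auto simp: B_def max_def field_simps)
  define P where "P n = {p \<in> prime_factors n. p < N}" for n
  have finP: "finite (P n)" for n by (simp add: P_def)
  have main: "real (card {d. d dvd n}) \<le> B ^ card (P n) * real n powr \<epsilon>" if "n > 0" for n :: nat
    using that
  proof (induction n rule: less_induct)
    case (less n)
    show ?case
    proof (cases "n = 1")
      case True
      then show ?thesis by (simp add: P_def)
    next
      case False
      then obtain p where p: "prime p" "p dvd n" using prime_factor_nat by blast
      define k where "k = multiplicity p n"
      obtain m where n: "n = p ^ k * m" and pm: "\<not> p dvd m"
        using multiplicity_decompose'[of n p] less.prems p(1) by (metis k_def neq0_conv not_prime_unit)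
      have k: "k > 0" using p less.prems by (simp add: k_def prime_multiplicity_gt_zero_iff)
      have m: "m > 0" using less.prems n by (cases "m = 0") auto
      have p2: "p \<ge> 2" using p(1) by (rule prime_ge_2_nat)
      have "1 < p ^ k" using p2 k by (intro one_less_power) auto
      then have "m < n" using m n by simp
      have "prime_factors n = insert p (prime_factors m)"
        using p k m unfolding n by (subst prime_factors_product) (auto simp: prime_prime_factors prime_factors_power)
      moreover have "p \<notin> prime_factors m" using pm by auto
      ultimately have cardP: "card (P n) = card (P m) + (if p < N then 1 else 0)"
      proof -
        assume a: "prime_factors n = insert p (prime_factors m)" "p \<notin> prime_factors m"
        have "P n = (if p < N then insert p (P m) else P m)" using a by (auto simp: P_def)
        moreover have "p \<notin> P m" using a by (simp add: P_def)
        ultimately show ?thesis using finP by simp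
      qed
      have pk: "real (k + 1) \<le> (if p < N then B else 1) * real (p ^ k) powr \<epsilon>"
      proof -
        have eq: "real (p ^ k) powr \<epsilon> = exp (k * (\<epsilon> * ln p))"
          using p2 by (simp add: powr_def ln_realpow mult_ac)
        have ge: "1 + k * (\<epsilon> * ln p) \<le> real (p ^ k) powr \<epsilon>" unfolding eq by (rule exp_ge_add_one_self)
        show ?thesis
        proof (cases "p < N")
          case True
          have "ln 2 \<le> ln (real p)" using p2 by simp
          then have "B * (\<epsilon> * ln 2) \<le> B * (\<epsilon> * ln p)"
            using B \<epsilon> by (intro mult_left_mono) auto
          with B(2) have "1 \<le> B * (\<epsilon> * ln p)" by (rule order_trans)
          then have "real k * 1 \<le> real k * (B * (\<epsilon> * ln p))" by (intro mult_left_mono) auto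
          then have "real (k + 1) \<le> B * (1 + k * (\<epsilon> * ln p))" using B by (simp add: algebra_simps)
          also have "\<dots> \<le> B * real (p ^ k) powr \<epsilon>" using ge B by (intro mult_left_mono) auto
          finally show ?thesis using True by simp
        next
          case False
          then have "2 powr (1 / \<epsilon>) \<le> real p" unfolding N_def by linarith
          then have "(2 powr (1 / \<epsilon>)) powr \<epsilon> \<le> real p powr \<epsilon>" using \<epsilon> by (intro powr_mono2) auto
          then have 2: "2 \<le> real p powr \<epsilon>" using \<epsilon> by (simp add: powr_powr)
          have "real (k + 1) \<le> 2 ^ k"
            by (induction k) auto
          also have "\<dots> \<le> (real p powr \<epsilon>) ^ k" using 2 by (intro power_mono) auto
          also have "\<dots> = real (p ^ k) powr \<epsilon>" using p2 by (simp add: powr_power powr_powr mult.commute flip: powr_realpow)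
          finally show ?thesis using False by simp
        qed
      qed
      have "real (card {d. d dvd n}) \<le> real ((k + 1) * card {d. d dvd m})"
        unfolding n using card_divisors_prime_power_mult_le[OF p(1) m] by (simp only: of_nat_le_iff)
      also have "\<dots> = real (k + 1) * real (card {d. d dvd m})" by (simp only: of_nat_mult)
      also have "\<dots> \<le> ((if p < N then B else 1) * real (p ^ k) powr \<epsilon>) * (B ^ card (P m) * real m powr \<epsilon>)"
        using pk less.IH[OF \<open>m < n\<close> m] B by (intro mult_mono) (auto intro!: mult_nonneg_nonneg)
      also have "\<dots> = B ^ card (P n) * real n powr \<epsilon>"
        unfolding cardP by (simp add: n powr_mult)
      finally show ?thesis .
    qed
  qed
  show ?thesis
  proof (intro exI[of _ "B ^ N"] conjI allI impI)
    show "B ^ N \<ge> 1" using B by simp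
    fix n :: nat assume n: "n > 0"
    have "card (P n) \<le> card {..<N}" by (intro card_mono) (auto simp: P_def)
    then have "B ^ card (P n) \<le> B ^ N" using B by (intro power_increasing) auto
    then have "B ^ card (P n) * real n powr \<epsilon> \<le> B ^ N * real n powr \<epsilon>" by (intro mult_right_mono) auto
    with main[OF n] show "real (card {d. d dvd n}) \<le> B ^ N * real n powr \<epsilon>" by linarith
  qed
qed

section \<open>The variance\<close>

text \<open>Here \<open>b\<close> is a residue in \<open>{..<q}\<close>, whereas
  \<open>totatives q\<close> lives in \<open>{1..q}\<close>; this is why \<open>a mod q\<close>
  appears later. A sum of indicators is easier to exchange with other sums than a
  cardinality.\<close>

definition res_count :: "nat \<Rightarrow> nat \<Rightarrow> nat \<Rightarrow> nat \<Rightarrow> real" where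
  "res_count q d k b = (\<Sum>l=1..k. of_bool ((d^2 * l) mod q = b))"

definition res_disc :: "nat \<Rightarrow> nat \<Rightarrow> nat \<Rightarrow> nat \<Rightarrow> real" where
  "res_disc q d k b = res_count q d k b - real k / real q"

lemma res_count_card: "res_count q d k b = real (card {l \<in> {1..k}. (d^2 * l) mod q = b})"
  by (simp add: res_count_def of_bool_def sum.If_cases Int_def)

lemma res_count_full:
  assumes q: "q > 0" "coprime d q" and b: "b < q"
  shows "res_count q d q b = 1"
proof -
  let ?f = "\<lambda>l. (d^2 * l) mod q"
  have inj: "inj_on ?f {1..q}"
  proof (rule inj_onI)
    fix l l' assume l: "l \<in> {1..q}" "l' \<in> {1..q}" and "?f l = ?f l'"
    then have "[d^2 * l = d^2 * l'] (mod q)" by (simp add: cong_def)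
    then have "[l = l'] (mod q)" using q(2) by (simp add: cong_mult_lcancel_nat)
    then have "[l - 1 = l' - 1] (mod q)" using l cong_diff_nat[of l l' q 1 1] by auto
    moreover have "l - 1 < q" "l' - 1 < q" using l by auto
    ultimately have "l - 1 = l' - 1" by (simp add: cong_less_modulus_unique_nat)
    then show "l = l'" using l by auto
  qed
  have "?f ` {1..q} = {..<q}"
  proof (rule card_subset_eq)
    show "?f ` {1..q} \<subseteq> {..<q}" using q by auto
    show "card (?f ` {1..q}) = card {..<q}" using card_image[OF inj] by simp
  qed simp
  then have "res_count q d q b = (\<Sum>c\<in>{..<q}. of_bool (c = b))"
    using sum.reindex[OF inj, of "\<lambda>c. of_bool (c = b) :: real"] by (simp add: res_count_def)
  also have "\<dots> = 1" using b by (simp add: of_bool_def)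
  finally show ?thesis .
qed

text \<open>A full period of \<open>q\<close> consecutive \<open>l\<close> hits each residue exactly
  once, because \<open>d^2\<close> is a unit, and the main term \<open>q / q\<close> cancels this.
  It lets every length be taken below \<open>q\<close>, as the box count requires.\<close>

lemma res_disc_mod:
  assumes q: "q > 0" "coprime d q" and b: "b < q"
  shows "res_disc q d (k mod q) b = res_disc q d k b"
proof -
  have step: "res_disc q d (q + k) b = res_disc q d k b" for k
  proof -
    have "{1..q + k} = {1..q} \<union> {1 + q..k + q}" by auto
    then have "res_count q d (q + k) b = res_count q d q b + (\<Sum>l=1+q..k+q. of_bool ((d^2 * l) mod q = b))"
      unfolding res_count_def by (simp only:) (rule sum.union_disjoint, auto)
    also have "(\<Sum>l=1+q..k+q. of_bool ((d^2 * l) mod q = b)) = (\<Sum>l=1..k. of_bool ((d^2 * (l + q)) mod q = b) :: real)"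
      by (rule sum.shift_bounds_cl_nat_ivl)
    also have "\<dots> = res_count q d k b" by (simp add: res_count_def distrib_left)
    finally show ?thesis
      using res_count_full[OF q b] q by (simp add: res_disc_def field_simps)
  qed
  have "res_disc q d (n * q + r) b = res_disc q d r b" for n r
    by (induction n) (simp_all add: step add.assoc)
  from this[of "k div q" "k mod q"] show ?thesis by simp
qed

lemma sum_res_count:
  assumes "q > 0"
  shows "(\<Sum>b<q. res_count q d k b) = k"
proof -
  have "(\<Sum>b<q. res_count q d k b) = (\<Sum>l=1..k. \<Sum>b<q. of_bool ((d^2 * l) mod q = b))"
    unfolding res_count_def by (rule sum.swap)
  also have "\<dots> = (\<Sum>l=1..k. 1)"
    using assms by (intro sum.cong) (simp_all add: of_bool_def)
  finally show ?thesis by simp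
qed

text \<open>Two intervals meet in a residue once for each pair \<open>(l, l')\<close> with
  \<open>d^2 * l = d'^2 * l'\<close> modulo \<open>q\<close>: this is where the lattice
  enters.\<close>

lemma sum_res_count_mult:
  assumes "q > 0"
  shows "(\<Sum>b<q. res_count q d k b * res_count q d' k' b) =
           card (lat_box (int q) ((int d)^2) ((int d')^2) {0<..int k} {0<..int k'})"
proof -
  let ?L = "{(l, l'). l \<in> {1..k} \<and> l' \<in> {1..k'} \<and> (d^2 * l) mod q = (d'^2 * l') mod q}"
  have "(\<Sum>b<q. res_count q d k b * res_count q d' k' b) =
      (\<Sum>b<q. \<Sum>l=1..k. \<Sum>l'=1..k'. of_bool ((d^2 * l) mod q = b) * of_bool ((d'^2 * l') mod q = b))"
    by (simp only: res_count_def sum_product)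
  also have "\<dots> = (\<Sum>l=1..k. \<Sum>b<q. \<Sum>l'=1..k'. of_bool ((d^2 * l) mod q = b) * of_bool ((d'^2 * l') mod q = b))"
    by (rule sum.swap)
  also have "\<dots> = (\<Sum>l=1..k. \<Sum>l'=1..k'. \<Sum>b<q. of_bool ((d^2 * l) mod q = b) * of_bool ((d'^2 * l') mod q = b))"
    by (rule sum.cong[OF refl], rule sum.swap)
  also have "\<dots> = (\<Sum>l=1..k. \<Sum>l'=1..k'. of_bool ((d^2 * l) mod q = (d'^2 * l') mod q))"
  proof (intro sum.cong refl)
    fix l l'
    have "(\<Sum>b<q. of_bool ((d^2 * l) mod q = b) * of_bool ((d'^2 * l') mod q = b)) =
        (\<Sum>b<q. if b = (d^2 * l) mod q then of_bool ((d'^2 * l') mod q = (d^2 * l) mod q) else (0::real))"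
      by (intro sum.cong) auto
    also have "\<dots> = of_bool ((d^2 * l) mod q = (d'^2 * l') mod q)"
      using assms by auto
    finally show "(\<Sum>b<q. of_bool ((d^2 * l) mod q = b) * of_bool ((d'^2 * l') mod q = b)) =
        (of_bool ((d^2 * l) mod q = (d'^2 * l') mod q) :: real)" .
  qed
  also have "\<dots> = (\<Sum>p\<in>{1..k} \<times> {1..k'}. of_bool ((d^2 * fst p) mod q = (d'^2 * snd p) mod q))"
    unfolding sum.cartesian_product by (intro sum.cong) auto
  also have "\<dots> = real (card {p \<in> {1..k} \<times> {1..k'}. (d^2 * fst p) mod q = (d'^2 * snd p) mod q})"
    by (simp add: of_bool_def sum.If_cases Int_def)
  also have "{p \<in> {1..k} \<times> {1..k'}. (d^2 * fst p) mod q = (d'^2 * snd p) mod q} = ?L" by auto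
  also have "card ?L = card (lat_box (int q) ((int d)^2) ((int d')^2) {0<..int k} {0<..int k'})"
  proof (rule bij_betw_same_card)
    have iff: "(d^2 * l) mod q = (d'^2 * l') mod q \<longleftrightarrow> int q dvd int l * (int d)^2 - int l' * (int d')^2" for l l'
    proof -
      have "(d^2 * l) mod q = (d'^2 * l') mod q \<longleftrightarrow> int (d^2 * l) mod int q = int (d'^2 * l') mod int q"
        by (simp only: of_nat_mod[symmetric] of_nat_eq_iff)
      also have "\<dots> \<longleftrightarrow> int q dvd int (d^2 * l) - int (d'^2 * l')" by (rule mod_eq_dvd_iff)
      finally show ?thesis by (simp add: mult.commute)
    qed
    show "bij_betw (\<lambda>(l, l'). (int l, int l')) ?L (lat_box (int q) ((int d)^2) ((int d')^2) {0<..int k} {0<..int k'})"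
      by (rule bij_betwI[of _ _ _ "\<lambda>(a, b). (nat a, nat b)"]) (auto simp: lat_box_def iff)
  qed
  finally show ?thesis .
qed

text \<open>Each count sums to its length over all residues, so the cross terms and the constant
  term combine to \<open>- k * k' / q\<close>, which is exactly minus the area of the box over the
  determinant.\<close>

lemma res_disc_correlation:
  fixes q d d' k k' K :: nat
  assumes q: "q > 0" "coprime d q" "coprime d' q" and k: "k \<le> K" "k' \<le> K" "K \<le> q"
  shows "\<bar>\<Sum>b<q. res_disc q d k b * res_disc q d' k' b\<bar> \<le> 5 * K / minlen (int q) ((int d)^2) ((int d')^2)"
proof -
  let ?c = "res_count q d k" and ?c' = "res_count q d' k'"
  have "(\<Sum>b<q. res_disc q d k b * res_disc q d' k' b) =
      (\<Sum>b<q. ?c b * ?c' b - k' / q * ?c b - k / q * ?c' b + k / q * (k' / q))"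
    by (simp add: res_disc_def algebra_simps)
  also have "\<dots> = (\<Sum>b<q. ?c b * ?c' b) - k' / q * (\<Sum>b<q. ?c b) - k / q * (\<Sum>b<q. ?c' b) + q * (k / q * (k' / q))"
    by (simp add: sum.distrib sum_subtractf sum_distrib_left)
  also have "\<dots> = (\<Sum>b<q. ?c b * ?c' b) - real k * real k' / q"
    using q by (simp add: sum_res_count field_simps)
  also have "(\<Sum>b<q. ?c b * ?c' b) = card (lat_box (int q) ((int d)^2) ((int d')^2) {0<..int k} {0<..int k'})"
    by (rule sum_res_count_mult[OF q(1)])
  finally have "(\<Sum>b<q. res_disc q d k b * res_disc q d' k' b) =
      real (card (lat_box (int q) ((int d)^2) ((int d')^2) {0<..int k} {0<..int k'})) - real k * real k' / q" .
  moreover have "coprime ((int d)^2) (int q)" "coprime ((int d')^2) (int q)" using q by auto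
  ultimately show ?thesis
    using lat_box_count[of "int q" "(int d)^2" "(int d')^2" "int k" "int K" "int k'"] q k by simp
qed

section \<open>The error term as a sum of discrepancies\<close>

text \<open>From \<open>d^2 dvd n\<close> and \<open>n \<le> x\<close> follows
  \<open>d \<le> sqrt x\<close>. Moreover \<open>d\<close> divides \<open>n\<close>, which is
  congruent to the unit \<open>a\<close>, so only \<open>d\<close> coprime to \<open>q\<close>
  occur; this makes \<open>d^2\<close> invertible in all that follows.\<close>

lemma sqfree_count_eq_sum:
  assumes q: "q > 0" and x: "x \<ge> 1" and a: "coprime a q"
  shows "sqfree_count x q a = (\<Sum>d | d \<in> {1..nat \<lfloor>sqrt x\<rfloor>} \<and> coprime d q.
           moebius d * res_count q d (nat \<lfloor>x / real d ^ 2\<rfloor>) (a mod q))"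
proof -
  define m where "m = nat \<lfloor>sqrt x\<rfloor>"
  define D where "D = {d. d \<in> {1..m} \<and> coprime d q}"
  define X where "X = {n. 1 \<le> n \<and> real n \<le> x \<and> [n = a] (mod q)}"
  have finX: "finite X" unfolding X_def by (rule finite_sqfree_count_range)
  have finD: "finite D" by (simp add: D_def)
  have inner: "real_of_int \<bar>moebius n\<bar> = (\<Sum>d\<in>D. if d^2 dvd n then real_of_int (moebius d) else 0)" if n: "n \<in> X" for n
  proof -
    have n1: "n > 0" "real n \<le> x" "[n = a] (mod q)" using n by (auto simp: X_def)
    have cop: "coprime n q" using n1(3) a by (metis cong_imp_coprime cong_sym)
    have "{d. d^2 dvd n} = {d \<in> D. d^2 dvd n}"
    proof (intro equalityI subsetI)
      fix d assume "d \<in> {d. d^2 dvd n}"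
      then have d: "d^2 dvd n" by simp
      then have "d > 0" using n1(1) by (cases "d = 0") auto
      have "d^2 \<le> n" using d n1(1) by (rule dvd_imp_le)
      then have "real d ^ 2 \<le> x" using n1(2) by (metis of_nat_le_iff of_nat_power order_trans)
      then have "real d \<le> sqrt x" by (rule real_le_rsqrt)
      then have "d \<le> m" unfolding m_def by (rule le_nat_floor)
      moreover have "coprime d q"
      proof -
        have "d dvd n" using d by (metis dvd_trans dvd_triv_left power2_eq_square)
        with cop show ?thesis by (metis coprime_divisors dvd_refl)
      qed
      ultimately show "d \<in> {d \<in> D. d^2 dvd n}" using d \<open>d > 0\<close> by (simp add: D_def)
    qed auto
    then have "real_of_int \<bar>moebius n\<bar> = (\<Sum>d \<in> {d \<in> D. d^2 dvd n}. real_of_int (moebius d))"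
      using abs_moebius_eq_sum[OF n1(1)] by simp
    also have "\<dots> = (\<Sum>d\<in>D. if d^2 dvd n then real_of_int (moebius d) else 0)"
      using finD by (rule sum.inter_filter)
    finally show ?thesis .
  qed
  have "sqfree_count x q a = (\<Sum>n\<in>X. \<Sum>d\<in>D. if d^2 dvd n then real_of_int (moebius d) else 0)"
    unfolding sqfree_count_def X_def[symmetric] by (intro sum.cong refl inner)
  also have "\<dots> = (\<Sum>d\<in>D. \<Sum>n\<in>X. if d^2 dvd n then real_of_int (moebius d) else 0)"
    by (rule sum.swap)
  also have "\<dots> = (\<Sum>d\<in>D. moebius d * res_count q d (nat \<lfloor>x / real d ^ 2\<rfloor>) (a mod q))"
  proof (rule sum.cong)
    fix d assume "d \<in> D"
    then have d: "d > 0" by (simp add: D_def)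
    let ?k = "nat \<lfloor>x / real d ^ 2\<rfloor>"
    have le_iff: "real (d^2 * l) \<le> x \<longleftrightarrow> l \<le> ?k" for l
    proof -
      have "real (d^2 * l) \<le> x \<longleftrightarrow> real l \<le> x / real d ^ 2"
        using d by (simp add: field_simps)
      also have "\<dots> \<longleftrightarrow> l \<le> ?k" using x by (simp add: le_nat_iff le_floor_iff)
      finally show ?thesis .
    qed
    have "(\<Sum>n\<in>X. if d^2 dvd n then real_of_int (moebius d) else 0) = moebius d * real (card {n \<in> X. d^2 dvd n})"
      using finX by (simp add: sum.If_cases Int_def)
    also have "card {n \<in> X. d^2 dvd n} = card {l \<in> {1..?k}. (d^2 * l) mod q = a mod q}"
    proof (rule bij_betw_same_card[symmetric])
      show "bij_betw (\<lambda>l. d^2 * l) {l \<in> {1..?k}. (d^2 * l) mod q = a mod q} {n \<in> X. d^2 dvd n}"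
      proof (rule bij_betwI[of _ _ _ "\<lambda>n. n div d^2"])
        show "(\<lambda>l. d^2 * l) \<in> {l \<in> {1..?k}. (d^2 * l) mod q = a mod q} \<rightarrow> {n \<in> X. d^2 dvd n}"
        proof
          fix l assume l: "l \<in> {l \<in> {1..?k}. (d^2 * l) mod q = a mod q}"
          then have "real (d^2 * l) \<le> x" unfolding le_iff by simp
          moreover have "1 \<le> d^2 * l" using l d by simp
          ultimately show "d^2 * l \<in> {n \<in> X. d^2 dvd n}" using l
            by (simp only: X_def mem_Collect_eq cong_def) simp
        qed
        show "(\<lambda>n. n div d^2) \<in> {n \<in> X. d^2 dvd n} \<rightarrow> {l \<in> {1..?k}. (d^2 * l) mod q = a mod q}"
        proof
          fix n assume n: "n \<in> {n \<in> X. d^2 dvd n}"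
          then obtain l where l: "n = d^2 * l" by auto
          have "n div d^2 = l" using d l by simp
          moreover have "l > 0" using n l by (cases "l = 0") (auto simp: X_def)
          moreover have "real (d^2 * l) \<le> x" using n unfolding l by (simp only: X_def mem_Collect_eq)
          then have "l \<le> ?k" unfolding le_iff .
          moreover have "(d^2 * l) mod q = a mod q" using n unfolding l by (simp add: X_def cong_def)
          ultimately show "n div d^2 \<in> {l \<in> {1..?k}. (d^2 * l) mod q = a mod q}" by simp
        qed
      qed (use d in auto)
    qed
    finally show "(\<Sum>n\<in>X. if d^2 dvd n then real_of_int (moebius d) else 0) = moebius d * res_count q d ?k (a mod q)"
      by (simp only: res_count_card)
  qed simp
  finally show ?thesis by (simp add: D_def m_def)
qed

text \<open>The 3 is 1 + 2. Replacing the integer part of \<open>x / d^2\<close> by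
  \<open>x / d^2\<close> costs at most \<open>1 / q\<close> for each of at most
  \<open>sqrt x\<close> values of \<open>d\<close>. Truncating the density at \<open>m\<close> costs
  \<open>x / q * (1 / m)\<close>, where \<open>m \<ge> sqrt x / 2\<close>.\<close>

lemma sqfree_error_approx:
  assumes q: "q > 0" and x: "x \<ge> 1" and a: "coprime a q"
  shows "\<bar>sqfree_error x q a - (\<Sum>d | d \<in> {1..nat \<lfloor>sqrt x\<rfloor>} \<and> coprime d q.
           moebius d * res_disc q d (nat \<lfloor>x / real d ^ 2\<rfloor> mod q) (a mod q))\<bar> \<le> 3 * sqrt x / q"
proof -
  define m where "m = nat \<lfloor>sqrt x\<rfloor>"
  define D where "D = {d. d \<in> {1..m} \<and> coprime d q}"
  define k where "k d = nat \<lfloor>x / real d ^ 2\<rfloor>" for d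
  have finD: "finite D" by (simp add: D_def)
  have sx: "sqrt x \<ge> 1" using x by simp
  have m: "m > 0" "real m \<le> sqrt x" and "sqrt x < real m + 1"
    using sx unfolding m_def by linarith+
  then have m2: "sqrt x \<le> 2 * real m" by linarith
  have aq: "a mod q < q" using q by simp
  have "sqfree_count x q a = (\<Sum>d\<in>D. moebius d * res_count q d (k d) (a mod q))"
    unfolding D_def m_def k_def by (rule sqfree_count_eq_sum[OF q x a])
  also have "\<dots> = (\<Sum>d\<in>D. moebius d * res_disc q d (k d mod q) (a mod q) + moebius d * (k d / q))"
  proof (intro sum.cong refl)
    fix d assume "d \<in> D"
    then have "res_disc q d (k d mod q) (a mod q) = res_disc q d (k d) (a mod q)"
      using q aq by (intro res_disc_mod) (auto simp: D_def)
    then have c: "res_count q d (k d) (a mod q) = res_disc q d (k d mod q) (a mod q) + k d / q"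
      by (simp add: res_disc_def[of q d "k d"])
    show "moebius d * res_count q d (k d) (a mod q) =
        moebius d * res_disc q d (k d mod q) (a mod q) + moebius d * (k d / q)"
      by (simp only: c distrib_left)
  qed
  finally have 1: "sqfree_error x q a - (\<Sum>d\<in>D. moebius d * res_disc q d (k d mod q) (a mod q)) =
      (\<Sum>d\<in>D. moebius d * (k d / q)) - sqfree_density q * (x / q)"
    by (simp add: sqfree_error_def sum.distrib)
  define s where "s = (\<Sum>d\<in>D. moebius d / real d ^ 2)"
  have "(\<Sum>d\<in>D. moebius d * (k d / q)) - sqfree_density q * (x / q) =
      (\<Sum>d\<in>D. moebius d * ((k d - x / real d ^ 2) / q)) + x / q * (s - sqfree_density q)"
    by (simp add: s_def sum_distrib_left right_diff_distrib diff_divide_distrib sum_subtractf mult_ac)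
  also have "\<bar>\<dots>\<bar> \<le> \<bar>\<Sum>d\<in>D. moebius d * ((k d - x / real d ^ 2) / q)\<bar> + \<bar>x / q * (s - sqfree_density q)\<bar>"
    by (rule abs_triangle_ineq)
  also have "\<dots> \<le> sqrt x / q + 2 * sqrt x / q"
  proof (rule add_mono)
    have "\<bar>\<Sum>d\<in>D. moebius d * ((k d - x / real d ^ 2) / q)\<bar> \<le> (\<Sum>d\<in>D. 1 * (1 / q))"
    proof (rule order_trans[OF sum_abs], rule sum_mono)
      fix d assume "d \<in> D"
      have "x / real d ^ 2 \<ge> 0" using x by simp
      then have "\<bar>k d - x / real d ^ 2\<bar> \<le> 1" unfolding k_def by linarith
      then have "\<bar>(k d - x / real d ^ 2) / q\<bar> \<le> 1 / q" by (simp add: abs_divide divide_right_mono)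
      then show "\<bar>moebius d * ((k d - x / real d ^ 2) / q)\<bar> \<le> 1 * (1 / q)"
        unfolding abs_mult by (intro mult_mono abs_moebius_le_1) auto
    qed
    also have "\<dots> = card D / q" by simp
    also have "\<dots> \<le> sqrt x / q"
    proof (rule divide_right_mono)
      have "card D \<le> card {1..m}" by (intro card_mono) (auto simp: D_def)
      then show "real (card D) \<le> sqrt x" using m by simp
    qed simp
    finally show "\<bar>\<Sum>d\<in>D. moebius d * ((k d - x / real d ^ 2) / q)\<bar> \<le> sqrt x / q" .
    have "\<bar>s - sqfree_density q\<bar> \<le> 1 / m"
      using sqfree_density_approx[OF q m(1)] by (simp add: s_def D_def abs_minus_commute)
    also have "1 / real m = 2 / (2 * real m)" by simp
    also have "\<dots> \<le> 2 / sqrt x" using m2 sx m(1) by (intro divide_left_mono) auto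
    finally have "x / q * \<bar>s - sqfree_density q\<bar> \<le> x / q * (2 / sqrt x)"
      using x by (intro mult_left_mono) auto
    also have "\<dots> = 2 * (x / sqrt x) / q" by (simp add: mult_ac)
    also have "x / sqrt x = sqrt x" using x by (simp add: real_div_sqrt)
    finally show "\<bar>x / q * (s - sqfree_density q)\<bar> \<le> 2 * sqrt x / q" using x by (simp add: abs_mult)
  qed
  finally show ?thesis unfolding 1[unfolded D_def k_def m_def] unfolding D_def k_def m_def by simp
qed

text \<open>Reduction modulo \<open>q\<close> is injective on \<open>{1..q}\<close>,
  \<open>q\<close> itself standing for the class of 0, and the residues that are not units only add
  nonnegative terms.\<close>

lemma sum_totatives_mod_le:
  fixes f :: "nat \<Rightarrow> real"
  assumes q: "q > 0" and f: "\<And>b. f b \<ge> 0"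
  shows "(\<Sum>a\<in>totatives q. f (a mod q)) \<le> (\<Sum>b<q. f b)"
proof -
  have "inj_on (\<lambda>a. a mod q) (totatives q)"
  proof (rule inj_onI)
    fix a b assume ab: "a \<in> totatives q" "b \<in> totatives q" "a mod q = b mod q"
    then have "a \<in> {1..q}" "b \<in> {1..q}" by (auto simp: totatives_def)
    then show "a = b" using ab(3) by (cases "a = q"; cases "b = q") auto
  qed
  then have "(\<Sum>a\<in>totatives q. f (a mod q)) = sum f ((\<lambda>a. a mod q) ` totatives q)"
    by (simp add: sum.reindex)
  also have "\<dots> \<le> (\<Sum>b<q. f b)" using q f by (intro sum_mono2) auto
  finally show ?thesis .
qed

lemma card_int_divisors:
  assumes "n > 0"
  shows "card {d. d dvd int n \<and> d > 0} = card {d. d dvd n}"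
proof (rule bij_betw_same_card)
  show "bij_betw nat {d. d dvd int n \<and> d > 0} {d. d dvd n}"
  proof (rule bij_betwI[of _ _ _ int])
    show "nat \<in> {d. d dvd int n \<and> d > 0} \<rightarrow> {d. d dvd n}"
      by (auto simp: nat_dvd_iff) 
    show "int \<in> {d. d dvd n} \<rightarrow> {d. d dvd int n \<and> d > 0}"
      using assms by (auto intro!: Nat.gr0I)
  qed auto
qed

section \<open>Dyadic blocks and the final bound\<close>

text \<open>The weights will be Moebius values. They are removed by absolute values, since no
  cancellation between different pairs is used. The constant is 5 from
  \<open>res_disc_correlation\<close>, 9 from \<open>sum_inverse_minlen\<close>, and 4 because
  \<open>B\<close> is twice \<open>2^j\<close>, so that \<open>B^2\<close> is
  \<open>4 * 4^j\<close>.\<close>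

lemma res_disc_block_variance:
  fixes q j :: nat and x :: real and D :: "nat set" and w :: "nat \<Rightarrow> real"
  assumes q: "q > 0" and x: "x \<ge> 1"
    and D: "\<And>d. d \<in> D \<Longrightarrow> 2^j \<le> d \<and> d < 2^(j+1) \<and> coprime d q"
    and w: "\<And>d. \<bar>w d\<bar> \<le> 1"
  defines "\<tau> \<equiv> real (card {d. d dvd q})"
  shows "(\<Sum>b<q. (\<Sum>d\<in>D. w d * res_disc q d (nat \<lfloor>x / real d ^ 2\<rfloor> mod q) b)^2) \<le>
           180 * \<tau>^2 * (1 + ln q) * (2 + real j) * (sqrt (x * q) + x / sqrt q)"
proof -
  define g where "g d b = res_disc q d (nat \<lfloor>x / real d ^ 2\<rfloor> mod q) b" for d b
  define k where "k d = nat \<lfloor>x / real d ^ 2\<rfloor>" for d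
  \<comment> \<open>One bound for all lengths of the block: a remainder modulo \<open>q\<close> is
    below \<open>q\<close>, and \<open>d \<ge> 2^j\<close> gives
    \<open>x / d^2 \<le> x / 4^j\<close>.\<close>
  define K where "K = min q (nat \<lfloor>x / 4^j\<rfloor>)"
  define B where "B = (2::int)^(j+1)"
  define U where "U = {a. 0 < a \<and> a \<le> B \<and> coprime a (int q)}"
  let ?m = "\<lambda>a b. real (minlen (int q) (a^2) (b^2))"
  have B: "B > 0" by (simp add: B_def)
  have finD: "finite D" by (rule finite_subset[of _ "{..<2^(j+1)}"]) (use D in auto)
  have finU: "finite U" by (rule finite_subset[of _ "{0..B}"]) (auto simp: U_def)
  have DU: "int d \<in> U" if "d \<in> D" for d
  proof -
    have d: "2^j \<le> d" "d < 2^(j+1)" "coprime d q" using D[OF that] by auto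
    have "(1::nat) \<le> 2^j" by simp
    then have "d > 0" using d by linarith
    moreover have "int d < int (2^(j+1))" using d by (simp only: of_nat_less_iff)
    ultimately show ?thesis using d by (simp add: U_def B_def)
  qed
  have kK: "k d mod q \<le> K" if "d \<in> D" for d
  proof -
    have "real (2^j) \<le> real d" using D[OF that] by (simp only: of_nat_le_iff)
    then have "(2^j)^2 \<le> real d ^ 2" by (intro power_mono) auto
    then have "4^j \<le> real d ^ 2" by (simp add: power2_eq_square flip: power_mult_distrib)
    moreover from this have "0 < real d ^ 2" by (rule less_le_trans[rotated]) simp
    ultimately have "x / real d ^ 2 \<le> x / 4^j" using x by (intro divide_left_mono mult_pos_pos) auto
    then have "k d \<le> nat \<lfloor>x / 4^j\<rfloor>" unfolding k_def by (intro nat_mono floor_mono)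
    then show ?thesis using q by (auto simp: K_def intro: order_trans[OF mod_less_eq_dividend] less_imp_le)
  qed
  have "(\<Sum>b<q. (\<Sum>d\<in>D. w d * g d b)^2) = (\<Sum>b<q. \<Sum>d\<in>D. \<Sum>e\<in>D. (w d * g d b) * (w e * g e b))"
    by (simp only: power2_eq_square sum_product)
  also have "\<dots> = (\<Sum>d\<in>D. \<Sum>b<q. \<Sum>e\<in>D. (w d * g d b) * (w e * g e b))"
    by (rule sum.swap)
  also have "\<dots> = (\<Sum>d\<in>D. \<Sum>e\<in>D. \<Sum>b<q. (w d * g d b) * (w e * g e b))"
    by (rule sum.cong[OF refl], rule sum.swap)
  also have "\<dots> = (\<Sum>d\<in>D. \<Sum>e\<in>D. (w d * w e) * (\<Sum>b<q. g d b * g e b))"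
    by (simp only: sum_distrib_left mult_ac)
  also have "\<dots> \<le> (\<Sum>d\<in>D. \<Sum>e\<in>D. 5 * K * (1 / ?m (int d) (int e)))"
  proof (intro sum_mono)
    fix d e assume de: "d \<in> D" "e \<in> D"
    have "(w d * w e) * (\<Sum>b<q. g d b * g e b) \<le> \<bar>w d * w e\<bar> * \<bar>\<Sum>b<q. g d b * g e b\<bar>"
      by (metis abs_ge_self abs_mult)
    also have "\<dots> \<le> 1 * (5 * K / ?m (int d) (int e))"
    proof (rule mult_mono)
      show "\<bar>w d * w e\<bar> \<le> 1" using mult_mono[OF w w, of d e] by (simp add: abs_mult mult.commute)
      show "\<bar>\<Sum>b<q. g d b * g e b\<bar> \<le> 5 * K / ?m (int d) (int e)"
        unfolding g_def k_def[symmetric]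
        by (rule res_disc_correlation) (use q D de kK in \<open>auto simp: K_def\<close>)
    qed auto
    finally show "(w d * w e) * (\<Sum>b<q. g d b * g e b) \<le> 5 * K * (1 / ?m (int d) (int e))" by simp
  qed
  also have "\<dots> = 5 * K * (\<Sum>p\<in>D \<times> D. 1 / ?m (int (fst p)) (int (snd p)))"
    unfolding sum_distrib_left sum.cartesian_product by (intro sum.cong) auto
  also have "(\<Sum>p\<in>D \<times> D. 1 / ?m (int (fst p)) (int (snd p))) = (\<Sum>p\<in>(\<lambda>p. (int (fst p), int (snd p))) ` (D \<times> D). 1 / ?m (fst p) (snd p))"
    by (subst sum.reindex) (auto simp: inj_on_def)
  \<comment> \<open>The lower end of the block has served its purpose in \<open>K\<close> and is
    dropped here.\<close>
  also have "\<dots> \<le> (\<Sum>p\<in>U \<times> U. 1 / ?m (fst p) (snd p))"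
    using finU DU by (intro sum_mono2) auto
  also have "\<dots> \<le> 9 * \<tau>^2 * (1 + ln q) * (1 + ln B) * (B + B^2 / sqrt q)"
    using sum_inverse_minlen[of "int q" B] q B
    by (simp add: U_def \<tau>_def card_int_divisors case_prod_beta)
  finally have 1: "(\<Sum>b<q. (\<Sum>d\<in>D. w d * g d b)^2) \<le>
      5 * K * (9 * \<tau>^2 * (1 + ln q) * (1 + ln B) * (B + B^2 / sqrt q))"
    by (simp add: mult_left_mono)
  have Bj: "real_of_int B = 2 * 2^j" by (simp add: B_def)
  have lnB: "1 + ln B \<le> 2 + real j"
  proof -
    have "ln B = (j + 1) * ln 2" unfolding Bj by (simp add: ln_mult ln_realpow algebra_simps)
    also have "\<dots> \<le> real (j + 1) * 1" using ln_2_less_1 by (intro mult_left_mono) auto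
    finally show ?thesis by simp
  qed
  have sq: "sqrt q > 0" using q by simp
  have K1: "real K \<le> q" by (simp add: K_def)
  have K2: "real K * 4^j \<le> x"
  proof -
    have "x / 4^j \<ge> 0" using x by simp
    then have "real K \<le> x / 4^j" unfolding K_def by linarith
    then show ?thesis by (simp add: field_simps)
  qed
  \<comment> \<open>The geometric mean of \<open>K1\<close> and \<open>K2\<close>.\<close>
  have K3: "real K * 2^j \<le> sqrt (x * q)"
  proof (rule real_le_rsqrt)
    have "(real K * 2^j)^2 = (real K * 4^j) * real K"
      by (simp add: power2_eq_square algebra_simps flip: power_mult_distrib)
    also have "\<dots> \<le> x * q" using K1 K2 x by (intro mult_mono) auto
    finally show "(real K * 2^j)^2 \<le> x * q" .
  qed
  have "real K * (B + B^2 / sqrt q) = 2 * (real K * 2^j) + 4 * (real K * 4^j / sqrt q)"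
  proof -
    have "real_of_int (B^2) = 4 * 4^j"
      unfolding of_int_power Bj by (simp add: power2_eq_square flip: power_mult_distrib)
    then show ?thesis unfolding Bj by (simp only: distrib_left mult_ac) simp
  qed
  also have "\<dots> \<le> 4 * sqrt (x * q) + 4 * (x / sqrt q)"
  proof (rule add_mono)
    have "sqrt (x * q) \<ge> 0" using x by simp
    then show "2 * (real K * 2^j) \<le> 4 * sqrt (x * q)" using K3 by linarith
    show "4 * (real K * 4^j / sqrt q) \<le> 4 * (x / sqrt q)"
      using K2 sq by (intro mult_left_mono divide_right_mono) auto
  qed
  finally have 2: "real K * (B + B^2 / sqrt q) \<le> 4 * (sqrt (x * q) + x / sqrt q)" by simp
  have lnq: "1 + ln q \<ge> 0" using q by simp
  have "5 * K * (9 * \<tau>^2 * (1 + ln q) * (1 + ln B) * (B + B^2 / sqrt q)) =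
      (45 * \<tau>^2 * (1 + ln q)) * ((1 + ln B) * (real K * (B + B^2 / sqrt q)))"
    by (simp only: mult_ac) simp
  also have "\<dots> \<le> (45 * \<tau>^2 * (1 + ln q)) * ((2 + real j) * (4 * (sqrt (x * q) + x / sqrt q)))"
  proof (rule mult_left_mono)
    show "(1 + ln B) * (real K * (B + B^2 / sqrt q)) \<le> (2 + real j) * (4 * (sqrt (x * q) + x / sqrt q))"
      by (rule mult_mono[OF lnB 2]) (use B sq in auto)
  qed (use lnq in auto)
  also have "\<dots> = 180 * \<tau>^2 * (1 + ln q) * (2 + real j) * (sqrt (x * q) + x / sqrt q)" by simp
  finally show ?thesis using 1 unfolding g_def by linarith
qed

text \<open>The four logarithms are \<open>1 + ln q\<close> and \<open>2 + j\<close> from one block,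
  and the square of the number of blocks. The approximation error of
  \<open>sqfree_error_approx\<close> contributes \<open>18 * x / q\<close> after summation over
  residues, which \<open>M\<close> dominates.\<close>

lemma sqfree_variance_bound:
  fixes q :: nat and x :: real
  assumes q: "q > 0" and x: "x \<ge> 1" and qx: "real q \<le> x"
  defines "\<tau> \<equiv> real (card {d. d dvd q})"
  shows "sqfree_variance x q \<le> 1098 * (1 + ln x)^4 * \<tau>^2 * (sqrt (x * q) + x / sqrt q)"
proof -
  define m where "m = nat \<lfloor>sqrt x\<rfloor>"
  define D where "D = {d. d \<in> {1..m} \<and> coprime d q}"
  define J where "J = floor_log m + 1"
  define L where "L = 1 + ln x"
  define M where "M = sqrt (x * q) + x / sqrt q"
  define h where "h d b = moebius d * res_disc q d (nat \<lfloor>x / real d ^ 2\<rfloor> mod q) b" for d b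
  define Dj where "Dj j = {d \<in> D. floor_log d = j}" for j
  define G where "G b = (\<Sum>d\<in>D. h d b)" for b
  have finD: "finite D" by (simp add: D_def)
  have sx: "sqrt x \<ge> 1" using x by simp
  have m: "m > 0" "real m \<le> sqrt x" using sx unfolding m_def by linarith+
  have L1: "L \<ge> 1" using x by (simp add: L_def)
  \<comment> \<open>From \<open>2 ^ floor_log m \<le> sqrt x\<close>: the square root halves the
    logarithm, and \<open>ln 2 \<ge> 1 / 2\<close> compensates for the base.\<close>
  have JL: "real J \<le> L"
  proof -
    have "real (2 ^ floor_log m) \<le> real m" using floor_log_exp2_le[of m] m by (simp only: of_nat_le_iff)
    from this m(2) have "real (2 ^ floor_log m) \<le> sqrt x" by (rule order_trans)
    then have "2 ^ floor_log m \<le> sqrt x" by simp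
    then have "ln (2 ^ floor_log m) \<le> ln (sqrt x)" by (intro ln_mono) auto
    then have "floor_log m * ln 2 \<le> ln x / 2" using x by (simp add: ln_realpow ln_sqrt)
    moreover have "floor_log m * (1/2) \<le> floor_log m * ln (2::real)"
      using ln2_ge_two_thirds by (intro mult_left_mono) auto
    ultimately show ?thesis by (simp add: J_def L_def)
  qed
  have M0: "M \<ge> 0" using x by (simp add: M_def)
  have fl: "floor_log d < J" if "d \<in> D" for d
    using that floor_log_mono[THEN monoD, of d m] by (simp add: D_def J_def)
  have block: "(\<Sum>b<q. (\<Sum>d\<in>Dj j. h d b)^2) \<le> 180 * \<tau>^2 * L * (2 * L) * M" if j: "j < J" for j
  proof -
    have "(\<Sum>b<q. (\<Sum>d\<in>Dj j. h d b)^2) \<le> 180 * \<tau>^2 * (1 + ln q) * (2 + real j) * M"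
      unfolding h_def M_def \<tau>_def
    proof (rule res_disc_block_variance[OF q x])
      fix d assume "d \<in> Dj j"
      then have "d > 0" "floor_log d = j" "coprime d q" by (auto simp: Dj_def D_def)
      then show "2^j \<le> d \<and> d < 2^(j+1) \<and> coprime d q"
        using floor_log_exp2_le[of d] floor_log_exp2_gt[of d] by auto
    qed (rule abs_moebius_le_1)
    also have "\<dots> \<le> 180 * \<tau>^2 * L * (2 * L) * M"
    proof (intro mult_right_mono mult_mono mult_left_mono)
      show "1 + ln q \<le> L" using qx q by (simp add: L_def)
      show "2 + real j \<le> 2 * L" using j JL L1 by linarith
    qed (use M0 L1 q in auto)
    finally show ?thesis .
  qed
  \<comment> \<open>Cauchy-Schwarz over the blocks gives one factor \<open>J\<close>; adding up the
    block bounds gives the second.\<close>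
  have "(\<Sum>b<q. (G b)^2) \<le> (\<Sum>b<q. (\<Sum>j<J. (\<Sum>d\<in>Dj j. h d b)^2) * J)"
  proof (rule sum_mono)
    fix b
    have "G b = (\<Sum>j<J. \<Sum>d\<in>Dj j. h d b)"
      unfolding G_def Dj_def using finD fl by (intro sum.group[symmetric]) auto
    then show "(G b)^2 \<le> (\<Sum>j<J. (\<Sum>d\<in>Dj j. h d b)^2) * J"
      using sum_squared_le_sum_of_squares[of "\<lambda>j. \<Sum>d\<in>Dj j. h d b" "{..<J}"] by simp
  qed
  also have "\<dots> = (\<Sum>j<J. \<Sum>b<q. (\<Sum>d\<in>Dj j. h d b)^2) * J"
    by (subst sum.swap) (simp add: sum_distrib_right)
  also have "\<dots> \<le> (\<Sum>j<J. 180 * \<tau>^2 * L * (2 * L) * M) * J"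
    using block by (intro mult_right_mono sum_mono) auto
  also have "\<dots> = 360 * \<tau>^2 * L^2 * M * (real J)^2" by (simp add: power2_eq_square)
  also have "\<dots> \<le> 360 * \<tau>^2 * L^2 * M * L^2"
    using JL M0 by (intro mult_left_mono power_mono) auto
  also have "\<dots> = 360 * L^4 * \<tau>^2 * M" by (simp add: power_def numeral_eq_Suc)
  finally have G: "(\<Sum>b<q. (G b)^2) \<le> 360 * L^4 * \<tau>^2 * M" .
  have err: "(sqfree_error x q a)^2 \<le> 2 * (G (a mod q))^2 + 18 * x / q^2" if a: "a \<in> totatives q" for a
  proof -
    have "coprime a q" using a by (simp add: totatives_def)
    then have "\<bar>sqfree_error x q a - G (a mod q)\<bar> \<le> 3 * sqrt x / q"
      unfolding G_def h_def D_def m_def by (rule sqfree_error_approx[OF q x])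
    then have "\<bar>sqfree_error x q a - G (a mod q)\<bar>^2 \<le> (3 * sqrt x / q)^2"
      by (intro power_mono) auto
    then have "(sqfree_error x q a - G (a mod q))^2 \<le> 9 * x / q^2"
      using x by (simp add: power_divide power_mult_distrib)
    moreover have "(sqfree_error x q a)^2 \<le> 2 * (G (a mod q))^2 + 2 * (sqfree_error x q a - G (a mod q))^2"
    proof -
      have "0 \<le> (2 * G (a mod q) - sqfree_error x q a)^2" by simp
      then show ?thesis by (simp add: power2_eq_square algebra_simps)
    qed
    ultimately show ?thesis by linarith
  qed
  have "sqfree_variance x q \<le> (\<Sum>a\<in>totatives q. 2 * (G (a mod q))^2 + 18 * x / q^2)"
    unfolding sqfree_variance_def by (intro sum_mono err)
  also have "\<dots> \<le> (\<Sum>b<q. 2 * (G b)^2 + 18 * x / q^2)"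
    using x by (intro sum_totatives_mod_le[OF q]) auto
  also have "\<dots> = 2 * (\<Sum>b<q. (G b)^2) + 18 * (x / q)"
    using q by (simp add: sum.distrib sum_distrib_left power2_eq_square)
  also have "\<dots> \<le> 2 * (360 * L^4 * \<tau>^2 * M) + 18 * (L^4 * \<tau>^2 * M)"
  proof -
    have "sqrt q \<le> q" using q by (intro real_le_lsqrt) (auto simp: power2_eq_square)
    then have "x / q \<le> x / sqrt q" using x q by (intro divide_left_mono) auto
    also have "\<dots> \<le> M" using x by (simp add: M_def)
    also have "1 * M \<le> (L^4 * \<tau>^2) * M"
    proof (intro mult_right_mono)
      have "card {1::nat} \<le> card {d. d dvd q}" using q by (intro card_mono) auto
      then have "\<tau> \<ge> 1" by (simp add: \<tau>_def)
      then show "1 \<le> L^4 * \<tau>^2" using L1 mult_mono[of 1 "L^4" 1 "\<tau>^2"] by simp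
    qed (rule M0)
    finally have "x / q \<le> L^4 * \<tau>^2 * M" by simp
    with G show ?thesis by linarith
  qed
  \<comment> \<open>The left side equals \<open>738 * L^4 * \<tau>^2 * M\<close>; the constant is
    generous.\<close>
  also have "\<dots> \<le> 1098 * L^4 * \<tau>^2 * M"
    using M0 L1 by (simp add: mult_nonneg_nonneg)
  finally show ?thesis by (simp add: L_def M_def)
qed

text \<open>Half of the exponent \<epsilon> pays for the fourth power of the logarithm, at
  \<epsilon> / 8 each, and half for the square of the divisor function, at \<epsilon> / 4 each. The
  constant \<open>A\<close> comes from
  \<open>ln x \<le> x powr (\<epsilon> / 8) / (\<epsilon> / 8)\<close>.\<close>

lemma sqfree_variance_powr_bound:
  fixes \<epsilon> :: real
  assumes \<epsilon>: "\<epsilon> > 0"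
  shows "\<exists>C>0. \<forall>(x::real) (q::nat). x \<ge> 1 \<and> q \<ge> 1 \<and> real q \<le> x \<longrightarrow>
           sqfree_variance x q \<le> C * (x powr \<epsilon> * (sqrt x * sqrt q + x / sqrt q))"
proof -
  obtain C where C: "C \<ge> 1" "\<And>n. n > 0 \<Longrightarrow> real (card {d::nat. d dvd n}) \<le> C * real n powr (\<epsilon> / 4)"
    using card_divisors_le_powr[of "\<epsilon> / 4"] \<epsilon> by auto
  define A where "A = 1 + 8 / \<epsilon>"
  have A: "A > 0" using \<epsilon> by (simp add: A_def add_pos_pos)
  have "sqfree_variance x q \<le> (1098 * A^4 * C^2) * (x powr \<epsilon> * (sqrt x * sqrt q + x / sqrt q))"
    if x: "x \<ge> 1" and q: "q \<ge> 1" and qx: "real q \<le> x" for x :: real and q :: nat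
  proof -
    have "1 + ln x \<le> A * x powr (\<epsilon> / 8)"
    proof -
      have "ln x \<le> x powr (\<epsilon> / 8) / (\<epsilon> / 8)" using x \<epsilon> by (intro ln_powr_bound) auto
      moreover have "1 \<le> x powr (\<epsilon> / 8)" using x \<epsilon> by (intro ge_one_powr_ge_zero) auto
      ultimately show ?thesis by (simp add: A_def algebra_simps)
    qed
    then have "(1 + ln x)^4 \<le> (A * x powr (\<epsilon> / 8))^4"
      using x by (intro power_mono) auto
    also have "\<dots> = A^4 * x powr (\<epsilon> / 2)"
      using x by (simp add: power_mult_distrib powr_power)
    finally have 1: "(1 + ln x)^4 \<le> A^4 * x powr (\<epsilon> / 2)" .
    have "real (card {d. d dvd q}) \<le> C * real q powr (\<epsilon> / 4)" using C(2) q by simp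
    also have "\<dots> \<le> C * x powr (\<epsilon> / 4)"
      using C(1) q qx \<epsilon> by (intro mult_left_mono powr_mono2) auto
    finally have "(real (card {d. d dvd q}))^2 \<le> (C * x powr (\<epsilon> / 4))^2"
      by (intro power_mono) auto
    also have "\<dots> = C^2 * x powr (\<epsilon> / 2)"
      using x by (simp add: power_mult_distrib powr_power)
    finally have 2: "(real (card {d. d dvd q}))^2 \<le> C^2 * x powr (\<epsilon> / 2)" .
    have M: "sqrt x * sqrt q + x / sqrt q \<ge> 0" using x by simp
    have "sqfree_variance x q \<le> 1098 * (1 + ln x)^4 * (real (card {d. d dvd q}))^2 * (sqrt x * sqrt q + x / sqrt q)"
      using sqfree_variance_bound[of q x] x q qx by (simp add: real_sqrt_mult)
    also have "\<dots> \<le> 1098 * (A^4 * x powr (\<epsilon> / 2)) * (C^2 * x powr (\<epsilon> / 2)) * (sqrt x * sqrt q + x / sqrt q)"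
      using 1 2 M A x by (intro mult_right_mono mult_mono mult_left_mono) auto
    also have "\<dots> = (1098 * A^4 * C^2) * (x powr (\<epsilon> / 2) * x powr (\<epsilon> / 2) * (sqrt x * sqrt q + x / sqrt q))"
      by (simp only: mult_ac)
    also have "x powr (\<epsilon> / 2) * x powr (\<epsilon> / 2) = x powr \<epsilon>"
      using x by (simp flip: powr_add)
    finally show ?thesis .
  qed
  moreover have "1098 * A^4 * C^2 > 0" using A C(1) by simp
  ultimately show ?thesis by blast
qed

theorem theorem1:
  fixes \<epsilon> :: real
  assumes "\<epsilon> > 0"
  shows "(\<exists>C>0. \<forall>(x::real) (q::nat). x \<ge> 1 \<and> q \<ge> 1 \<and> real q \<le> x \<longrightarrow>
            \<bar>sqfree_variance x q\<bar> \<le>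
              C * (x powr \<epsilon> * (x powr (1/2) * real q powr (1/2) + x / real q powr (1/2))))
       \<and> (\<exists>C>0. \<forall>(x::real) (q::nat). x \<ge> 1 \<and> q \<ge> 1 \<and> x powr (1/2) \<le> real q \<and> real q \<le> x \<longrightarrow>
            \<bar>sqfree_variance x q\<bar> \<le> C * (x powr (1/2 + \<epsilon>) * real q powr (1/2)))"
proof -
  obtain C where C: "C > 0" and V: "\<And>x q. x \<ge> 1 \<Longrightarrow> q \<ge> 1 \<Longrightarrow> real q \<le> x \<Longrightarrow>
      sqfree_variance x q \<le> C * (x powr \<epsilon> * (sqrt x * sqrt q + x / sqrt q))"
    using sqfree_variance_powr_bound[OF assms] by blast
  have abs: "\<bar>sqfree_variance x q\<bar> = sqfree_variance x q" for x q
    by (simp add: sqfree_variance_def sum_nonneg)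
  show ?thesis
  proof (rule conjI)
    show "\<exists>C>0. \<forall>(x::real) (q::nat). x \<ge> 1 \<and> q \<ge> 1 \<and> real q \<le> x \<longrightarrow>
            \<bar>sqfree_variance x q\<bar> \<le>
              C * (x powr \<epsilon> * (x powr (1/2) * real q powr (1/2) + x / real q powr (1/2)))"
      using C V by (intro exI[of _ C]) (auto simp: abs powr_half_sqrt)
    show "\<exists>C>0. \<forall>(x::real) (q::nat). x \<ge> 1 \<and> q \<ge> 1 \<and> x powr (1/2) \<le> real q \<and> real q \<le> x \<longrightarrow>
            \<bar>sqfree_variance x q\<bar> \<le> C * (x powr (1/2 + \<epsilon>) * real q powr (1/2))"
    \<comment> \<open>In this range \<open>sqrt x \<le> q\<close> makes the second term of the
      general bound at most the first, so the constant doubles.\<close>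
    proof (intro exI[of _ "2 * C"] conjI allI impI)
      fix x :: real and q :: nat
      assume a: "x \<ge> 1 \<and> q \<ge> 1 \<and> x powr (1/2) \<le> real q \<and> real q \<le> x"
      then have x: "x \<ge> 1" and q: "q \<ge> 1" and xq: "sqrt x \<le> real q" and qx: "real q \<le> x"
        by (auto simp: powr_half_sqrt)
      have "x / sqrt q = sqrt x * (sqrt x / sqrt q)" using x by simp
      also have "\<dots> \<le> sqrt x * (real q / sqrt q)"
        using x xq q by (intro mult_left_mono divide_right_mono) auto
      also have "real q / sqrt q = sqrt q" by (simp add: real_div_sqrt)
      finally have "sqrt x * sqrt q + x / sqrt q \<le> 2 * (sqrt x * sqrt q)" by simp
      then have "C * (x powr \<epsilon> * (sqrt x * sqrt q + x / sqrt q)) \<le> C * (x powr \<epsilon> * (2 * (sqrt x * sqrt q)))"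
        using C by (intro mult_left_mono) auto
      with V[OF x q qx] have "sqfree_variance x q \<le> C * (x powr \<epsilon> * (2 * (sqrt x * sqrt q)))" by linarith
      also have "\<dots> = 2 * C * (x powr (1/2 + \<epsilon>) * real q powr (1/2))"
        using x q by (simp add: powr_add powr_half_sqrt)
      finally show "\<bar>sqfree_variance x q\<bar> \<le> 2 * C * (x powr (1/2 + \<epsilon>) * real q powr (1/2))"
        by (simp add: abs)
    qed (use C in simp)
  qed
qed

end
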